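(* Let $\{F_j\}_{j\in\mathbb Z_+}$ be an ergodic (stationary) sequence of random distribution functions satisfying $$\mathbf E|X(z)|<\infty,\qquad \int_0^\infty\bigl\{1-\mathbb E(F_0(x))\bigr\}^{1/2}dx<\infty,\qquad\int_0^\infty\operatorname*{ess\,sup}_{\mathbb P}(1-F_0(x))\,dx<\infty .$$ Assume there exists $M>0$ such that $\mathbb P\{F_0(-M)=0,\ F_0(M)=1\}=1$. Let $\mu^*=\operatorname{ess\,sup}_{\mathbb P}\mu(F_0)$. Then, as $\alpha\searrow0$, $$\Psi(1,\alpha)=\mu^*+O(\sqrt\alpha).$$
   Context: $\mathbb P$ is the distribution of a sequence $(F_j)_{j\in\mathbb Z_+}$ of random Borel probability distributions on $\mathbb R$ (the environment), with expectation $\mathbb E$; $F_j(\cdot)$ also denotes the distribution function. Given $(F_j)$, the weights $\{X(i,j):(i,j)\in\mathbb Z_+^2\}$ are independent with $X(i,j)\sim F_j$; $\mathbf E$ is expectation over environment and weights. $T(k,\ell)$ is the maximum of $\sum_{z\in\pi}X(z)$ over all nearest-neighbor lattice paths $\pi$ from $(0,0)$ to $(k,\ell)$ with steps $(1,0)$ or $(0,1)$, the endpoint $(k,\ell)$ excluded. $\Psi(x,y)=\lim_{n\to\infty}\frac1nT(\lfloor nx\rfloor,\lfloor ny\rfloor)$, $(x,y)\in(0,\infty)^2$, is the deterministic limit, almost sure and in $L^1$. $\mu(F)$ is the mean of the distribution $F$. $\operatorname{ess\,sup}_{\mathbb P}f=\inf\{s\in\mathbb R:\mathbb P(f>s)=0\}$.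 *)

theory Defs
  imports "HOL-Probability.Probability" "HOL-Library.Landau_Symbols"
begin

abbreviation seq_space :: "'s measure \<Rightarrow> (nat \<Rightarrow> 's) measure" where
  "seq_space S \<equiv> PiM UNIV (\<lambda>_. S)"

definition stationary_seq :: "'w measure \<Rightarrow> 's measure \<Rightarrow> (nat \<Rightarrow> 'w \<Rightarrow> 's) \<Rightarrow> bool" where
  "stationary_seq M S F \<longleftrightarrow>
     (\<forall>j. F j \<in> measurable M S) \<and>
     distr M (seq_space S) (\<lambda>\<omega> j. F (Suc j) \<omega>) = distr M (seq_space S) (\<lambda>\<omega> j. F j \<omega>)"

definition ergodic_seq :: "'w measure \<Rightarrow> 's measure \<Rightarrow> (nat \<Rightarrow> 'w \<Rightarrow> 's) \<Rightarrow> bool" where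
  "ergodic_seq M S F \<longleftrightarrow>
     stationary_seq M S F \<and>
     (\<forall>A\<in>sets (seq_space S).
        {s \<in> space (seq_space S). (\<lambda>j. s (Suc j)) \<in> A} = A \<longrightarrow>
        measure M {\<omega> \<in> space M. (\<lambda>j. F j \<omega>) \<in> A} \<in> {0, 1})"

definition env_algebra :: "'w measure \<Rightarrow> (nat \<Rightarrow> 'w \<Rightarrow> real measure) \<Rightarrow> 'w measure" where
  "env_algebra M F = vimage_algebra (space M) (\<lambda>\<omega> j. F j \<omega>) (seq_space (prob_algebra borel))"

text \<open>
  The environment and the weights live on one probability space \<open>M\<close>. Conditionally on the
  environment, the weights are independent and \<open>X (i, j)\<close> has law \<open>F j\<close>: the conditional
  finite-dimensional distributions are products.
\<close>

definition weights_in_env ::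
  "'w measure \<Rightarrow> (nat \<Rightarrow> 'w \<Rightarrow> real measure) \<Rightarrow> (nat \<times> nat \<Rightarrow> 'w \<Rightarrow> real) \<Rightarrow> bool" where
  "weights_in_env M F X \<longleftrightarrow>
     (\<forall>z. X z \<in> borel_measurable M) \<and>
     (\<forall>J B. finite J \<longrightarrow> (\<forall>z\<in>J. B z \<in> sets borel) \<longrightarrow>
        (AE \<omega> in M.
           real_cond_exp M (env_algebra M F)
             (indicat_real {\<omega> \<in> space M. \<forall>z\<in>J. X z \<omega> \<in> B z}) \<omega>
           = (\<Prod>z\<in>J. measure (F (snd z) \<omega>) (B z))))"

definition lattice_step :: "nat \<times> nat \<Rightarrow> nat \<times> nat \<Rightarrow> bool" where
  "lattice_step z z' \<longleftrightarrow> z' = (Suc (fst z), snd z) \<or> z' = (fst z, Suc (snd z))"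

definition lattice_paths :: "nat \<Rightarrow> nat \<Rightarrow> (nat \<times> nat) list set" where
  "lattice_paths k l =
     {p. p \<noteq> [] \<and> hd p = (0, 0) \<and> last p = (k, l) \<and> successively lattice_step p}"

text \<open>The set of paths is finite and nonempty, so the maximum below is a genuine one.\<close>

lemma lattice_path_coords:
  assumes "p \<noteq> []" "successively lattice_step p"
  shows "fst (last p) + snd (last p) + 1 = fst (hd p) + snd (hd p) + length p \<and>
         (\<forall>z\<in>set p. fst z \<le> fst (last p) \<and> snd z \<le> snd (last p))"
  using assms
proof (induction p rule: induct_list012)
  case (3 x y zs)
  then have "lattice_step x y" and IH: "fst (last (y # zs)) + snd (last (y # zs)) + 1
      = fst y + snd y + length (y # zs)"
    "\<forall>z\<in>set (y # zs). fst z \<le> fst (last (y # zs)) \<and> snd z \<le> snd (last (y # zs))"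
    by auto
  moreover from \<open>lattice_step x y\<close>
  have "fst x \<le> fst y" "snd x \<le> snd y" "fst y + snd y = fst x + snd x + 1"
    by (auto simp: lattice_step_def)
  ultimately show ?case by (auto intro: order_trans)
qed auto

lemma finite_lattice_paths: "finite (lattice_paths k l)"
proof (rule finite_subset)
  show "lattice_paths k l \<subseteq> {p. set p \<subseteq> {..k} \<times> {..l} \<and> length p = k + l + 1}"
    using lattice_path_coords by (fastforce simp: lattice_paths_def)
  show "finite {p. set p \<subseteq> {..k} \<times> {..l} \<and> length p = k + l + 1}"
    by (intro finite_lists_length_eq) auto
qed

lemma lattice_paths_nonempty: "lattice_paths k l \<noteq> {}"
proof -
  have ext: "lattice_paths k' l' \<noteq> {}"
    if "lattice_paths k l \<noteq> {}" "lattice_step (k, l) (k', l')" for k l k' l'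
  proof -
    from that obtain p where "p \<in> lattice_paths k l" by auto
    with that(2) have "p @ [(k', l')] \<in> lattice_paths k' l'"
      by (auto simp: lattice_paths_def successively_append_iff)
    then show ?thesis by blast
  qed
  have "[(0, 0)] \<in> lattice_paths 0 0" by (simp add: lattice_paths_def)
  then have "lattice_paths 0 0 \<noteq> {}" by blast
  then have "lattice_paths k 0 \<noteq> {}"
    by (induction k) (use ext[of _ 0 "Suc _" 0] in \<open>simp_all add: lattice_step_def\<close>)
  then show ?thesis
    by (induction l) (use ext[of k _ k "Suc _"] in \<open>simp_all add: lattice_step_def\<close>)
qed

definition last_passage :: "(nat \<times> nat \<Rightarrow> real) \<Rightarrow> nat \<Rightarrow> nat \<Rightarrow> real" where
  "last_passage x k l = Max ((\<lambda>p. \<Sum>z\<leftarrow>butlast p. x z) ` lattice_paths k l)"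

definition scaled_passage ::
  "(nat \<times> nat \<Rightarrow> 'w \<Rightarrow> real) \<Rightarrow> nat \<Rightarrow> real \<Rightarrow> real \<Rightarrow> 'w \<Rightarrow> real" where
  "scaled_passage X n x y \<omega> =
     last_passage (\<lambda>z. X z \<omega>) (nat \<lfloor>real n * x\<rfloor>) (nat \<lfloor>real n * y\<rfloor>) / real n"

text \<open>
  \<open>\<Psi>\<close> is the deterministic almost sure and \<open>L\<^sup>1\<close> limit of the scaled last-passage times. This
  determines \<open>\<Psi>\<close> on the open quadrant and leaves it unconstrained elsewhere.
\<close>

definition is_passage_limit ::
  "'w measure \<Rightarrow> (nat \<times> nat \<Rightarrow> 'w \<Rightarrow> real) \<Rightarrow> (real \<Rightarrow> real \<Rightarrow> real) \<Rightarrow> bool" where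
  "is_passage_limit M X \<Psi> \<longleftrightarrow>
     (\<forall>x>0. \<forall>y>0.
        (AE \<omega> in M. (\<lambda>n. scaled_passage X n x y \<omega>) \<longlonglongrightarrow> \<Psi> x y) \<and>
        (\<lambda>n. \<integral>\<^sup>+ \<omega>. ennreal \<bar>scaled_passage X n x y \<omega> - \<Psi> x y\<bar> \<partial>M) \<longlonglongrightarrow> 0)"

definition dist_mean :: "real measure \<Rightarrow> real" where
  "dist_mean G = (\<integral>x. x \<partial>G)"

text \<open>
  The library's essential supremum needs a complete linear order, hence the passage through
  \<^typ>\<open>ereal\<close>; the value is finite for distributions that are almost surely supported in a fixed
  bounded interval.
\<close>

definition mu_star :: "'w measure \<Rightarrow> (nat \<Rightarrow> 'w \<Rightarrow> real measure) \<Rightarrow> real" where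
  "mu_star M F = real_of_ereal (esssup M (\<lambda>\<omega>. ereal (dist_mean (F 0 \<omega>))))"

end

theory Submission
  imports Defs
begin

text \<open>
  Let all weights lie in \<open>[-K, K]\<close>.

  \<^emph>\<open>Lower bound.\<close> For \<open>c < \<mu>*\<close> the event \<open>A = {\<mu>(F 0) > c}\<close> depends on the environment only
  and has positive probability. The path along row \<open>0\<close> and then straight up gives
  \<open>E[1_A T(n, n\<alpha>)] \<ge> P(A) (n c - n \<alpha> K)\<close>, hence \<open>\<Psi>(1, \<alpha>) \<ge> c - K \<alpha>\<close>.

  \<^emph>\<open>Upper bound.\<close> Every mean is at most \<open>\<mu>*\<close>, so it suffices to bound the passage time of the
  centered weights, which are independent given the environment. A union bound over all paths
  would lose a factor \<open>\<surd>(log (1 / \<alpha>))\<close>. Instead each row is cut into blocks of length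
  \<open>L \<approx> 1 / \<alpha>\<close>, and for a path only the blocks in which it changes rows are recorded: there are
  \<open>exp (O(n \<alpha>))\<close> such coarse paths. Within a row, all intervals with prescribed end blocks are
  controlled at once by the maxima of the partial sums and of their negatives. With \<open>\<lambda> = \<surd>\<alpha>\<close>,
  the moment \<open>E exp (\<lambda> T)\<close> is \<open>exp (O(n \<alpha>))\<close>, so that \<open>E T = O(n \<surd>\<alpha>)\<close>.
\<close>

section \<open>Coarse-grained lattice paths\<close>

text \<open>This is the maximum of the sums of the first \<open>k\<close> terms from index
  \<open>a\<close> on, over \<open>k\<close> from 0 to \<open>n\<close>. The recursion strips off
  the first term, so the remaining maximum does not involve \<open>y a\<close>; this allows one
  coordinate to be integrated at a time.\<close>

fun max_prefix :: "(nat \<Rightarrow> real) \<Rightarrow> nat \<Rightarrow> nat \<Rightarrow> real" where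
  "max_prefix y a 0 = 0"
| "max_prefix y a (Suc n) = max 0 (y a + max_prefix y (Suc a) n)"

lemma sum_le_max_prefix: "k \<le> n \<Longrightarrow> (\<Sum>u\<in>{a..<a + k}. y u) \<le> max_prefix y a n"
proof (induction n arbitrary: a k)
  case (Suc n)
  show ?case
  proof (cases k)
    case 0
    then show ?thesis by simp
  next
    case (Suc k')
    have "(\<Sum>u\<in>{a..<a + k}. y u) = y a + (\<Sum>u\<in>{Suc a..<Suc a + k'}. y u)"
      using Suc by (simp add: sum.atLeast_Suc_lessThan)
    also have "\<dots> \<le> y a + max_prefix y (Suc a) n"
      using Suc.IH[of k' "Suc a"] Suc Suc.prems by simp
    finally show ?thesis by simp
  qed
qed simp

lemma max_prefix_cong:
  "(\<And>u. u \<in> {a..<a + n} \<Longrightarrow> y u = y' u) \<Longrightarrow> max_prefix y a n = max_prefix y' a n"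
  by (induction n arbitrary: a) auto

text \<open>
  \<open>row_weight l L y j c c'\<close> dominates \<open>exp (l * s)\<close> for the sum \<open>s\<close> of \<open>y\<close> over any
  interval of row \<open>j\<close> that starts in block \<open>c\<close> and ends in block \<open>c'\<close>, the blocks having
  length \<open>L\<close>. Hence \<open>coarse_partition l L y j c\<close> dominates \<open>exp (l * s)\<close> for every path
  whose sum over the rows below \<open>j\<close> is \<open>s\<close> and which enters row \<open>j\<close> in block \<open>c\<close>.
\<close>

definition row_weight ::
  "real \<Rightarrow> nat \<Rightarrow> (nat \<times> nat \<Rightarrow> real) \<Rightarrow> nat \<Rightarrow> nat \<Rightarrow> nat \<Rightarrow> real" where
  "row_weight l L y j c c' =
     cosh (2 * l * max_prefix (\<lambda>u. y (u, j)) (c * L) ((c' + 1 - c) * L)) +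
     cosh (2 * l * max_prefix (\<lambda>u. - y (u, j)) (c * L) ((c' + 1 - c) * L))"

fun coarse_partition ::
  "real \<Rightarrow> nat \<Rightarrow> (nat \<times> nat \<Rightarrow> real) \<Rightarrow> nat \<Rightarrow> nat \<Rightarrow> real" where
  "coarse_partition l L y 0 c = (if c = 0 then 1 else 0)"
| "coarse_partition l L y (Suc j) c =
     (\<Sum>c'\<le>c. coarse_partition l L y j c' * row_weight l L y j c' c)"

lemma row_weight_nonneg: "0 \<le> row_weight l L y j c c'"
  unfolding row_weight_def by (intro add_nonneg_nonneg) auto

lemma coarse_partition_nonneg: "0 \<le> coarse_partition l L y j c"
  by (induction j arbitrary: c) (auto intro!: sum_nonneg mult_nonneg_nonneg row_weight_nonneg)

text \<open>AM-GM for \<open>exp (2 * a)\<close> and \<open>exp (2 * b)\<close>, followed by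
  \<open>exp x \<le> 2 * cosh x\<close>. It separates the two dependent maxima of a row, so that
  each can be integrated alone.\<close>

lemma exp_add_le_cosh: "exp (a + b) \<le> cosh (2 * a) + cosh (2 * b :: real)"
proof -
  have "2 * exp (a + b) \<le> exp (2 * a) + exp (2 * b)"
    using zero_le_power2[of "exp a - exp b"]
    by (simp add: power2_eq_square algebra_simps exp_add[symmetric])
  moreover have "exp x \<le> 2 * cosh x" for x :: real
    by (simp add: cosh_def)
  note this[of "2 * a"] this[of "2 * b"]
  ultimately show ?thesis by linarith
qed

text \<open>An interval sum is the difference of two prefix sums taken from the left end of the
  starting block. Both prefixes stay inside the same window of \<open>c + 1 - i div L\<close>
  blocks, wherever \<open>i\<close> and \<open>k\<close> lie in their blocks.\<close>

lemma exp_interval_le_row_weight: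
  assumes "0 \<le> l" "i \<le> k" "i div L \<le> c" "k \<le> (c + 1) * L"
  shows "exp (l * (\<Sum>u\<in>{i..<k}. y (u, j))) \<le> row_weight l L y j (i div L) c"
proof -
  define a where "a = i div L * L"
  define n where "n = (c + 1 - i div L) * L"
  have "(c + 1) * L = a + n"
    using assms(3) by (simp add: a_def n_def add_mult_distrib[symmetric])
  with assms have kn: "k \<le> a + n" by simp
  have ai: "a \<le> i" by (simp add: a_def)
  have split: "(\<Sum>u\<in>{i..<k}. y (u, j)) = (\<Sum>u\<in>{a..<k}. y (u, j)) + (\<Sum>u\<in>{a..<i}. - y (u, j))"
    using sum.atLeastLessThan_concat[of a i k "\<lambda>u. y (u, j)"] ai assms(2) by (simp add: sum_negf)
  have "(\<Sum>u\<in>{a..<k}. y (u, j)) \<le> max_prefix (\<lambda>u. y (u, j)) a n"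
    using sum_le_max_prefix[of "k - a" n "\<lambda>u. y (u, j)" a] kn ai assms(2) by auto
  moreover have "(\<Sum>u\<in>{a..<i}. - y (u, j)) \<le> max_prefix (\<lambda>u. - y (u, j)) a n"
    using sum_le_max_prefix[of "i - a" n "\<lambda>u. - y (u, j)" a] kn ai assms(2) by auto
  ultimately have "l * (\<Sum>u\<in>{i..<k}. y (u, j)) \<le>
      l * max_prefix (\<lambda>u. y (u, j)) a n + l * max_prefix (\<lambda>u. - y (u, j)) a n"
    unfolding split using assms(1) by (simp add: distrib_left[symmetric] mult_left_mono)
  then have "exp (l * (\<Sum>u\<in>{i..<k}. y (u, j))) \<le>
      exp (l * max_prefix (\<lambda>u. y (u, j)) a n + l * max_prefix (\<lambda>u. - y (u, j)) a n)"
    by simp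
  also have "\<dots> \<le> row_weight l L y j (i div L) c"
    using exp_add_le_cosh unfolding row_weight_def a_def n_def by (simp add: mult.assoc)
  finally show ?thesis .
qed

text \<open>Row \<open>j\<close> is left at column \<open>k\<close>. Both \<open>m = Suc k\<close>
  and \<open>m = k\<close> occur: a path that steps up has collected the site \<open>(k, j)\<close>,
  whereas the endpoint of a path is not collected.\<close>

lemma coarse_partition_next_row:
  assumes "0 < L" "0 \<le> l" "i \<le> m" "i \<le> k" "m \<le> Suc k"
    and "v \<le> coarse_partition l L y j (i div L) * exp (l * (\<Sum>u\<in>{i..<m}. y (u, j)))"
  shows "v \<le> coarse_partition l L y (Suc j) (k div L)"
proof -
  have "Suc k \<le> (k div L + 1) * L"
    using assms(1) dividend_less_div_times[of L k] by (simp add: algebra_simps Suc_le_eq)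
  then have "exp (l * (\<Sum>u\<in>{i..<m}. y (u, j))) \<le> row_weight l L y j (i div L) (k div L)"
    using assms by (intro exp_interval_le_row_weight div_le_mono) auto
  then have "v \<le> coarse_partition l L y j (i div L) * row_weight l L y j (i div L) (k div L)"
    using assms(6) mult_left_mono[OF _ coarse_partition_nonneg] by (meson order_trans)
  also have "\<dots> \<le> coarse_partition l L y (Suc j) (k div L)"
    using assms(4) unfolding coarse_partition.simps
    by (intro member_le_sum)
       (auto intro: div_le_mono mult_nonneg_nonneg coarse_partition_nonneg row_weight_nonneg)
  finally show ?thesis .
qed

text \<open>Induction along the path. The witness \<open>i\<close> is the column in which the path
  enters row \<open>j\<close>; \<open>coarse_partition\<close> pays for the completed rows, the last
  factor for the sites of row \<open>j\<close> collected so far.\<close>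

lemma exp_path_le:
  assumes "0 < L" "0 \<le> l" "p \<in> lattice_paths k j"
  shows "\<exists>i\<le>k. exp (l * (\<Sum>z\<leftarrow>butlast p. y z)) \<le>
     coarse_partition l L y j (i div L) * exp (l * (\<Sum>u\<in>{i..<k}. y (u, j)))"
  using assms(3)
proof (induction p arbitrary: k j rule: rev_induct)
  case Nil
  then show ?case by (simp add: lattice_paths_def)
next
  case (snoc z p)
  show ?case
  proof (cases "p = []")
    case True
    with snoc.prems show ?thesis by (auto simp: lattice_paths_def)
  next
    case False
    obtain k' j' where last: "last p = (k', j')" by force
    have z: "z = (k, j)" and step: "lattice_step (k', j') (k, j)" and p: "p \<in> lattice_paths k' j'"
      using snoc.prems False last by (auto simp: lattice_paths_def successively_append_iff)
    have "(\<Sum>z\<leftarrow>p. y z) = (\<Sum>z\<leftarrow>butlast p @ [(k', j')]. y z)"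
      using append_butlast_last_id[OF False] last by metis
    then have sum: "(\<Sum>z\<leftarrow>butlast (p @ [z]). y z) = (\<Sum>z\<leftarrow>butlast p. y z) + y (k', j')"
      by simp
    obtain i where i: "i \<le> k'" and IH: "exp (l * (\<Sum>z\<leftarrow>butlast p. y z)) \<le>
        coarse_partition l L y j' (i div L) * exp (l * (\<Sum>u\<in>{i..<k'}. y (u, j')))"
      using snoc.IH[OF p] by blast
    \<comment> \<open>As the endpoint of \<open>p\<close>, the site \<open>(k', j')\<close> was not
      counted; the longer path collects it.\<close>
    have ext: "exp (l * (\<Sum>z\<leftarrow>butlast (p @ [z]). y z)) \<le>
        coarse_partition l L y j' (i div L) * exp (l * (\<Sum>u\<in>{i..<Suc k'}. y (u, j')))"
      using mult_right_mono[OF IH, of "exp (l * y (k', j'))"] i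
      unfolding sum by (simp add: distrib_left exp_add mult.assoc)
    show ?thesis
    proof (cases "j = j'")
      case True
      then show ?thesis using ext step i by (intro exI[of _ i]) (auto simp: lattice_step_def)
    next
      case False
      then have [simp]: "k = k'" "j = Suc j'" using step by (auto simp: lattice_step_def)
      have "exp (l * (\<Sum>z\<leftarrow>butlast (p @ [z]). y z)) \<le> coarse_partition l L y (Suc j') (k' div L)"
        by (rule coarse_partition_next_row[OF assms(1,2) _ i _ ext]) (use i in auto)
      then show ?thesis by (intro exI[of _ k]) simp
    qed
  qed
qed

text \<open>The last row is closed as if the path went one step further up, hence
  \<open>Suc j\<close>. The resulting bound is the same for all paths with this endpoint.\<close>

lemma exp_path_le_coarse_partition:
  assumes "0 < L" "0 \<le> l" "p \<in> lattice_paths k j"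
  shows "exp (l * (\<Sum>z\<leftarrow>butlast p. y z)) \<le> coarse_partition l L y (Suc j) (k div L)"
proof -
  obtain i where i: "i \<le> k" and *: "exp (l * (\<Sum>z\<leftarrow>butlast p. y z)) \<le>
     coarse_partition l L y j (i div L) * exp (l * (\<Sum>u\<in>{i..<k}. y (u, j)))"
    using exp_path_le[OF assms] by blast
  show ?thesis
    by (rule coarse_partition_next_row[OF assms(1,2) i i _ *]) simp
qed

section \<open>Exponential moments of maximal partial sums\<close>

abbreviation field_space :: "(nat \<times> nat \<Rightarrow> real) measure" where
  "field_space \<equiv> PiM UNIV (\<lambda>_. borel)"

text \<open>Independence of the coordinates in \<open>I\<close> is encoded as invariance under
  changing them, so that all functions stay on the one space of full fields.\<close>

definition ignores :: "'i set \<Rightarrow> (('i \<Rightarrow> 'a) \<Rightarrow> 'b) \<Rightarrow> bool" where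
  "ignores I H \<longleftrightarrow> (\<forall>y y'. (\<forall>z. z \<notin> I \<longrightarrow> y z = y' z) \<longrightarrow> H y = H y')"

lemma ignoresI: "(\<And>y y'. (\<And>z. z \<notin> I \<Longrightarrow> y z = y' z) \<Longrightarrow> H y = H y') \<Longrightarrow> ignores I H"
  unfolding ignores_def by blast

lemma ignoresD: "ignores I H \<Longrightarrow> (\<And>z. z \<notin> I \<Longrightarrow> y z = y' z) \<Longrightarrow> H y = H y'"
  unfolding ignores_def by blast

lemma ignores_mono: "ignores I H \<Longrightarrow> J \<subseteq> I \<Longrightarrow> ignores J H"
  unfolding ignores_def by blast

text \<open>
  The only property of the centered weights that is needed: integrating out one coordinate costs
  at most the factor of Hoeffding's lemma, whatever the function of the other coordinates.
\<close>

definition subgaussian_field :: "real \<Rightarrow> (nat \<times> nat \<Rightarrow> real) measure \<Rightarrow> bool" where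
  "subgaussian_field K P \<longleftrightarrow> sets P = sets field_space \<and>
     (\<forall>z s H. H \<in> borel_measurable field_space \<longrightarrow> (\<forall>y. 0 \<le> H y) \<longrightarrow> ignores {z} H \<longrightarrow>
        (\<integral>\<^sup>+y. ennreal (exp (s * y z) * H y) \<partial>P) \<le> ennreal (exp (s\<^sup>2 * K\<^sup>2 / 2)) * (\<integral>\<^sup>+y. ennreal (H y) \<partial>P))"

lemma subgaussian_fieldD:
  assumes "subgaussian_field K P" "H \<in> borel_measurable field_space" "\<And>y. 0 \<le> H y" "ignores {z} H"
  shows "(\<integral>\<^sup>+y. ennreal (exp (s * y z) * H y) \<partial>P) \<le> ennreal (exp (s\<^sup>2 * K\<^sup>2 / 2)) * (\<integral>\<^sup>+y. ennreal (H y) \<partial>P)"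
  using assms unfolding subgaussian_field_def by blast

lemma measurable_max_prefix [measurable]:
  assumes [measurable]: "\<And>u. (\<lambda>x. f x u) \<in> borel_measurable N"
  shows "(\<lambda>x. max_prefix (f x) a n) \<in> borel_measurable N"
  by (induction n arbitrary: a) simp_all

lemma borel_measurable_cosh [measurable]: "cosh \<in> borel_measurable (borel :: real measure)"
  by (intro borel_measurable_continuous_onI continuous_intros)

lemma measurable_row_weight [measurable]: "(\<lambda>y. row_weight l L y j c c') \<in> borel_measurable field_space"
  unfolding row_weight_def by measurable

lemma measurable_coarse_partition [measurable]:
  "(\<lambda>y. coarse_partition l L y j c) \<in> borel_measurable field_space"
  by (induction j arbitrary: c) simp_all

text \<open>Only rows below \<open>j\<close> enter the recursion. Hence
  \<open>coarse_partition\<close> can serve as the factor \<open>H\<close> while row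
  \<open>j\<close> is integrated out.\<close>

lemma coarse_partition_ignores: "ignores {z. j \<le> snd z} (\<lambda>y. coarse_partition l L y j c)"
proof (induction j arbitrary: c)
  case 0
  then show ?case by (simp add: ignores_def)
next
  case (Suc j)
  show ?case
  proof (rule ignoresI)
    fix y y' :: "nat \<times> nat \<Rightarrow> real" assume *: "\<And>z. z \<notin> {z. Suc j \<le> snd z} \<Longrightarrow> y z = y' z"
    then have "row_weight l L y j c' c = row_weight l L y' j c' c" for c' c
      unfolding row_weight_def by simp
    moreover have "coarse_partition l L y j c' = coarse_partition l L y' j c'" for c'
      by (rule ignoresD[OF Suc]) (use * in auto)
    ultimately show "coarse_partition l L y (Suc j) c = coarse_partition l L y' (Suc j) c" by simp
  qed
qed

lemma ennreal_exp_mult: "ennreal (exp a) * (ennreal (exp b) * x) = ennreal (exp (a + b)) * x"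
  by (simp add: exp_add ennreal_mult mult.assoc)

text \<open>Evenness of \<open>cosh\<close> lets one discard the truncation at zero in the recursion for
  \<open>max_prefix\<close>: \<open>cosh (max 0 v) \<le> cosh v\<close>.\<close>

lemma nn_integral_cosh_max_prefix_le:
  assumes P: "subgaussian_field K P"
    and H: "H \<in> borel_measurable field_space" "\<And>y. 0 \<le> H y" "ignores {z. snd z = j} H"
    and e: "e = 1 \<or> e = - 1"
  shows "(\<integral>\<^sup>+y. ennreal (cosh (s * max_prefix (\<lambda>u. e * y (u, j)) a n) * H y) \<partial>P)
    \<le> ennreal (exp (s\<^sup>2 * K\<^sup>2 / 2 * n)) * (\<integral>\<^sup>+y. ennreal (H y) \<partial>P)"
proof (induction n arbitrary: a)
  case 0
  then show ?case by simp
next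
  case (Suc n)
  have sets: "sets P = sets field_space" using P by (simp add: subgaussian_field_def)
  note [measurable_cong] = sets
  note [measurable] = H(1)
  define U where "U y = max_prefix (\<lambda>u. e * y (u, j)) (Suc a) n" for y :: "nat \<times> nat \<Rightarrow> real"
  have [measurable]: "U \<in> borel_measurable field_space" unfolding U_def by measurable
  have ign: "ignores {(a, j)} (\<lambda>y. exp (r * U y) * H y / 2)" for r
  proof (rule ignoresI)
    fix y y' :: "nat \<times> nat \<Rightarrow> real" assume *: "\<And>z. z \<notin> {(a, j)} \<Longrightarrow> y z = y' z"
    have "H y = H y'" by (rule ignoresD[OF H(3)]) (use * in auto)
    moreover have "U y = U y'" unfolding U_def by (rule max_prefix_cong) (use * in auto)
    ultimately show "exp (r * U y) * H y / 2 = exp (r * U y') * H y' / 2" by simp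
  qed
  \<comment> \<open>Used for \<open>r = s\<close> and \<open>r = - s\<close>, the two halves of
    \<open>cosh\<close>. The signs of \<open>r\<close> and \<open>e\<close> do not matter because
    the bound depends on a square.\<close>
  have one: "(\<integral>\<^sup>+y. ennreal (exp (r * e * y (a, j)) * (exp (r * U y) * H y / 2)) \<partial>P) \<le>
      ennreal (exp (s\<^sup>2 * K\<^sup>2 / 2)) * (\<integral>\<^sup>+y. ennreal (exp (r * U y) * H y / 2) \<partial>P)"
    if "r\<^sup>2 = s\<^sup>2" for r
  proof -
    have "(r * e)\<^sup>2 = s\<^sup>2" using that e by (auto simp: power_mult_distrib)
    then show ?thesis
      using subgaussian_fieldD[OF P _ _ ign[of r], of "r * e"] H(2) by simp
  qed
  have "(\<integral>\<^sup>+y. ennreal (cosh (s * max_prefix (\<lambda>u. e * y (u, j)) a (Suc n)) * H y) \<partial>P) \<le>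
    (\<integral>\<^sup>+y. ennreal (exp (s * e * y (a, j)) * (exp (s * U y) * H y / 2)) +
           ennreal (exp (-s * e * y (a, j)) * (exp (-s * U y) * H y / 2)) \<partial>P)"
  proof (rule nn_integral_mono)
    fix y
    have "cosh (s * max 0 v) \<le> cosh (s * v)" for v :: real
      by (cases "0 \<le> v") (auto simp: max_def cosh_real_ge_1)
    from mult_right_mono[OF this[of "e * y (a, j) + U y"] H(2)[of y]]
    have "cosh (s * max_prefix (\<lambda>u. e * y (u, j)) a (Suc n)) * H y \<le>
       exp (s * e * y (a, j)) * (exp (s * U y) * H y / 2) + exp (-s * e * y (a, j)) * (exp (-s * U y) * H y / 2)"
      by (simp add: U_def cosh_field_def distrib_left exp_add exp_diff exp_minus field_simps)
    then show "ennreal (cosh (s * max_prefix (\<lambda>u. e * y (u, j)) a (Suc n)) * H y) \<le>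
       ennreal (exp (s * e * y (a, j)) * (exp (s * U y) * H y / 2)) +
       ennreal (exp (-s * e * y (a, j)) * (exp (-s * U y) * H y / 2))"
      using H(2) by (simp flip: ennreal_plus)
  qed
  also have "\<dots> = (\<integral>\<^sup>+y. ennreal (exp (s * e * y (a, j)) * (exp (s * U y) * H y / 2)) \<partial>P) +
           (\<integral>\<^sup>+y. ennreal (exp (-s * e * y (a, j)) * (exp (-s * U y) * H y / 2)) \<partial>P)"
    by (rule nn_integral_add) measurable
  also have "\<dots> \<le> ennreal (exp (s\<^sup>2 * K\<^sup>2 / 2)) * (\<integral>\<^sup>+y. ennreal (exp (s * U y) * H y / 2) \<partial>P) +
     ennreal (exp (s\<^sup>2 * K\<^sup>2 / 2)) * (\<integral>\<^sup>+y. ennreal (exp (-s * U y) * H y / 2) \<partial>P)"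
    by (intro add_mono one) auto
  also have "\<dots> = ennreal (exp (s\<^sup>2 * K\<^sup>2 / 2)) *
     (\<integral>\<^sup>+y. ennreal (exp (s * U y) * H y / 2) + ennreal (exp (-s * U y) * H y / 2) \<partial>P)"
    by (subst nn_integral_add) (auto simp: distrib_left)
  \<comment> \<open>The two exponentials recombine into a \<open>cosh\<close>, to which the
    induction hypothesis for the shorter window applies.\<close>
  also have "\<dots> = ennreal (exp (s\<^sup>2 * K\<^sup>2 / 2)) * (\<integral>\<^sup>+y. ennreal (cosh (s * U y) * H y) \<partial>P)"
    using H(2) by (simp add: cosh_field_def algebra_simps add_divide_distrib flip: ennreal_plus)
  also have "\<dots> \<le> ennreal (exp (s\<^sup>2 * K\<^sup>2 / 2)) * (ennreal (exp (s\<^sup>2 * K\<^sup>2 / 2 * n)) * (\<integral>\<^sup>+y. ennreal (H y) \<partial>P))"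
    using Suc.IH[of "Suc a"] unfolding U_def by (rule mult_left_mono) simp
  also have "\<dots> = ennreal (exp (s\<^sup>2 * K\<^sup>2 / 2 * Suc n)) * (\<integral>\<^sup>+y. ennreal (H y) \<partial>P)"
    unfolding ennreal_exp_mult by (simp add: algebra_simps add_divide_distrib)
  finally show ?case .
qed

text \<open>Each of the two \<open>cosh\<close> terms of \<open>row_weight\<close> is integrated
  with \<open>s = 2 * l\<close> over \<open>(c + 1 - c') * L\<close> sites, at a cost of
  \<open>exp (2 * l\<^sup>2 * K\<^sup>2)\<close> per site. The factor 2 counts the two
  terms.\<close>

lemma nn_integral_coarse_partition_step:
  assumes P: "subgaussian_field K P" and "c' \<le> c"
  shows "(\<integral>\<^sup>+y. ennreal (coarse_partition l L y j c' * row_weight l L y j c' c) \<partial>P)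
    \<le> ennreal (2 * exp (2 * l\<^sup>2 * K\<^sup>2 * L) ^ (c + 1 - c')) * (\<integral>\<^sup>+y. ennreal (coarse_partition l L y j c') \<partial>P)"
proof -
  have sets: "sets P = sets field_space" using P by (simp add: subgaussian_field_def)
  note [measurable_cong] = sets
  let ?H = "\<lambda>y. coarse_partition l L y j c'" and ?n = "(c + 1 - c') * L"
  define W where "W e y = cosh (2 * l * max_prefix (\<lambda>u. e * y (u, j)) (c' * L) ?n) * ?H y"
    for e :: real and y :: "nat \<times> nat \<Rightarrow> real"
  have [measurable]: "W e \<in> borel_measurable field_space" for e unfolding W_def by measurable
  have exp: "exp ((2 * l)\<^sup>2 * K\<^sup>2 / 2 * ?n) = exp (2 * l\<^sup>2 * K\<^sup>2 * L) ^ (c + 1 - c')"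
    unfolding exp_of_nat_mult[symmetric] by (simp add: power_mult_distrib mult_ac)
  have W: "(\<integral>\<^sup>+y. ennreal (W e y) \<partial>P) \<le>
      ennreal (exp (2 * l\<^sup>2 * K\<^sup>2 * L) ^ (c + 1 - c')) * (\<integral>\<^sup>+y. ennreal (?H y) \<partial>P)"
    if "e = 1 \<or> e = -1" for e
    unfolding W_def exp[symmetric]
    by (intro nn_integral_cosh_max_prefix_le P measurable_coarse_partition coarse_partition_nonneg that
          ignores_mono[OF coarse_partition_ignores]) auto
  have "(\<integral>\<^sup>+y. ennreal (?H y * row_weight l L y j c' c) \<partial>P) =
      (\<integral>\<^sup>+y. ennreal (W 1 y) + ennreal (W (-1) y) \<partial>P)"
    by (intro nn_integral_cong)
       (simp add: W_def row_weight_def distrib_left mult.commute coarse_partition_nonneg flip: ennreal_plus)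
  also have "\<dots> = (\<integral>\<^sup>+y. ennreal (W 1 y) \<partial>P) + (\<integral>\<^sup>+y. ennreal (W (-1) y) \<partial>P)"
    by (rule nn_integral_add) measurable
  also have "\<dots> \<le> ennreal (exp (2 * l\<^sup>2 * K\<^sup>2 * L) ^ (c + 1 - c')) * (\<integral>\<^sup>+y. ennreal (?H y) \<partial>P) +
      ennreal (exp (2 * l\<^sup>2 * K\<^sup>2 * L) ^ (c + 1 - c')) * (\<integral>\<^sup>+y. ennreal (?H y) \<partial>P)"
    by (intro add_mono W) auto
  also have "\<dots> = ennreal (2 * exp (2 * l\<^sup>2 * K\<^sup>2 * L) ^ (c + 1 - c')) * (\<integral>\<^sup>+y. ennreal (?H y) \<partial>P)"
    by (simp add: ennreal_mult mult.assoc flip: mult_2)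
  finally show ?thesis .
qed

text \<open>The powers of \<open>q\<close> multiply to \<open>q ^ (c + 1)\<close> whatever the
  intermediate block \<open>c'\<close>, and the weight \<open>2 ^ c'\<close> carried through the
  induction makes the sum over \<open>c'\<close> geometric, at most twice its last term. A row
  therefore costs the constant factor \<open>4 * q\<close> instead of one that grows with the number
  of blocks.\<close>

lemma nn_integral_coarse_partition_le:
  assumes P: "subgaussian_field K P" and "prob_space P" and q: "q = exp (2 * l\<^sup>2 * K\<^sup>2 * L)"
  shows "(\<integral>\<^sup>+y. ennreal (coarse_partition l L y j c) \<partial>P) \<le> ennreal ((4 * q) ^ j * (2 * q) ^ c)"
proof (induction j arbitrary: c)
  case 0
  interpret prob_space P by fact
  have "1 \<le> q" by (simp add: q)
  then have "1 \<le> (2 * q) ^ c" by (intro one_le_power) simp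
  then show ?case by (cases "c = 0") (simp_all add: emeasure_space_1 )
next
  case (Suc j)
  have sets: "sets P = sets field_space" using P by (simp add: subgaussian_field_def)
  note [measurable_cong] = sets
  have q0: "0 < q" by (simp add: q)
  have "(\<integral>\<^sup>+y. ennreal (coarse_partition l L y (Suc j) c) \<partial>P) =
     (\<integral>\<^sup>+y. (\<Sum>c'\<le>c. ennreal (coarse_partition l L y j c' * row_weight l L y j c' c)) \<partial>P)"
    by (intro nn_integral_cong)
       (simp add: sum_ennreal coarse_partition_nonneg row_weight_nonneg)
  also have "\<dots> = (\<Sum>c'\<le>c. \<integral>\<^sup>+y. ennreal (coarse_partition l L y j c' * row_weight l L y j c' c) \<partial>P)"
    by (rule nn_integral_sum) measurable
  also have "\<dots> \<le> (\<Sum>c'\<le>c. ennreal (2 * q ^ (c + 1 - c') * ((4 * q) ^ j * (2 * q) ^ c')))"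
  proof (rule sum_mono)
    fix c' assume "c' \<in> {..c}"
    then have "(\<integral>\<^sup>+y. ennreal (coarse_partition l L y j c' * row_weight l L y j c' c) \<partial>P) \<le>
        ennreal (2 * q ^ (c + 1 - c')) * (\<integral>\<^sup>+y. ennreal (coarse_partition l L y j c') \<partial>P)"
      unfolding q using nn_integral_coarse_partition_step[OF P] by simp
    also have "\<dots> \<le> ennreal (2 * q ^ (c + 1 - c')) * ennreal ((4 * q) ^ j * (2 * q) ^ c')"
      by (intro mult_left_mono Suc) simp
    finally show "(\<integral>\<^sup>+y. ennreal (coarse_partition l L y j c' * row_weight l L y j c' c) \<partial>P) \<le>
        ennreal (2 * q ^ (c + 1 - c') * ((4 * q) ^ j * (2 * q) ^ c'))"
      using q0 by (simp add: ennreal_mult)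
  qed
  also have "\<dots> = ennreal (\<Sum>c'\<le>c. 2 * q ^ (c + 1 - c') * ((4 * q) ^ j * (2 * q) ^ c'))"
    using q0 by (intro sum_ennreal) simp
  also have "(\<Sum>c'\<le>c. 2 * q ^ (c + 1 - c') * ((4 * q) ^ j * (2 * q) ^ c')) =
      2 * q * (4 * q) ^ j * q ^ c * (\<Sum>c'\<le>c. 2 ^ c')"
    unfolding sum_distrib_left
  proof (rule sum.cong[OF refl])
    fix c' assume "c' \<in> {..c}"
    then have *: "q ^ (c + 1 - c') * q ^ c' = q ^ (c + 1)" by (simp flip: power_add)
    have "2 * q ^ (c + 1 - c') * ((4 * q) ^ j * (2 * q) ^ c') =
        2 * (4 * q) ^ j * 2 ^ c' * (q ^ (c + 1 - c') * q ^ c')"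
      unfolding power_mult_distrib by (simp only: mult_ac)
    then show "2 * q ^ (c + 1 - c') * ((4 * q) ^ j * (2 * q) ^ c') = 2 * q * (4 * q) ^ j * q ^ c * 2 ^ c'"
      unfolding * by simp
  qed
  also have "\<dots> \<le> 2 * q * (4 * q) ^ j * q ^ c * (2 * 2 ^ c)"
  proof -
    have "(\<Sum>c'\<le>c. 2 ^ c' :: real) \<le> 2 * 2 ^ c"
      by (induction c) auto
    then show ?thesis using q0 by (intro mult_left_mono) auto
  qed
  also have "\<dots> = (4 * q) ^ Suc j * (2 * q) ^ c"
    by (simp add: power_mult_distrib)
  finally show ?case by (simp add: ennreal_leI)
qed

section \<open>Disintegration over the environment\<close>

text \<open>Hoeffding's lemma for an interval of length \<open>2 * K\<close>, where
  \<open>(2 * K)\<^sup>2 / 8 = K\<^sup>2 / 2\<close>. A negative \<open>s\<close> is turned into a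
  positive one by the reflection \<open>- x\<close>.\<close>

lemma hoeffding_centered:
  assumes "prob_space N" "sets N = sets borel" and AE: "AE x in N. x \<in> {-K..K::real}"
  shows "(\<integral>\<^sup>+x. ennreal (exp (s * (x - (\<integral>x. x \<partial>N)))) \<partial>N) \<le> ennreal (exp (s\<^sup>2 * K\<^sup>2 / 2))"
proof -
  interpret prob_space N by fact
  note [measurable_cong] = assms(2)
  have pos: "(\<integral>\<^sup>+x. ennreal (exp (l * (f x - (\<integral>x. f x \<partial>N)))) \<partial>N) \<le> ennreal (exp (l\<^sup>2 * K\<^sup>2 / 2))"
    if "0 < l" and [measurable]: "f \<in> borel_measurable N" and "AE x in N. f x \<in> {-K..K}" for l and f :: "real \<Rightarrow> real"
  proof -
    interpret interval_bounded_random_variable N f "- K" K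
      by unfold_locales (use that in auto)
    have "(K - - K)\<^sup>2 / 8 = K\<^sup>2 / 2" by (simp add: power2_eq_square)
    then show ?thesis
      using Hoeffdings_lemma_nn_integral[OF \<open>0 < l\<close>] by (simp add: mult.commute)
  qed
  consider "s = 0" | "0 < s" | "s < 0" by linarith
  then show ?thesis
  proof cases
    case 1
    then show ?thesis by (simp add: emeasure_space_1)
  next
    case 2
    then show ?thesis using pos[of s "\<lambda>x. x"] AE by simp
  next
    case 3
    have "AE x in N. - x \<in> {-K..K}" using AE by eventually_elim auto
    then show ?thesis using pos[of "- s" "\<lambda>x. - x"] 3 by (simp add: algebra_simps)
  qed
qed

text \<open>By Fubini the coordinate \<open>z\<close> is integrated first, the others being frozen.
  Centering acts on each coordinate separately, so \<open>H\<close> is constant in this inner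
  integral, and Hoeffding's lemma bounds what remains.\<close>

lemma subgaussian_field_centered_PiM:
  fixes N :: "nat \<times> nat \<Rightarrow> real measure"
  assumes prob: "\<And>z. prob_space (N z)" and sets: "\<And>z. sets (N z) = sets borel"
    and bd: "\<And>z. AE x in N z. x \<in> {-K..K}"
  shows "subgaussian_field K (distr (PiM UNIV N) field_space (\<lambda>x z. x z - (\<integral>x. x \<partial>N z)))"
    (is "subgaussian_field K (distr ?P _ ?c)")
proof -
  note [measurable_cong] = sets
  have [measurable_cong]: "sets ?P = sets field_space"
    by (rule sets_PiM_cong) (simp_all add: sets)
  have c [measurable]: "?c \<in> measurable ?P field_space"
    by (rule measurable_PiM_single') (simp_all add: space_PiM)
  have int: "(\<integral>\<^sup>+y. ennreal (exp (s * y z) * H y) \<partial>distr ?P field_space ?c) \<le>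
      ennreal (exp (s\<^sup>2 * K\<^sup>2 / 2)) * (\<integral>\<^sup>+y. ennreal (H y) \<partial>distr ?P field_space ?c)"
    if H [measurable]: "H \<in> borel_measurable field_space" and H0: "\<And>y. 0 \<le> H y" and ign: "ignores {z} H"
    for z s H
  proof -
    let ?I = "PiM (UNIV - {z}) N"
    interpret z: prob_space "N z" by (rule prob)
    interpret I: prob_space ?I by (rule prob_space_PiM) (rule prob)
    interpret pair_prob_space "N z" ?I ..
    have P: "?P = distr (N z \<Otimes>\<^sub>M ?I) ?P (\<lambda>(t, x). x(z := t))"
      using distr_pair_PiM_eq_PiM[of "UNIV - {z}" N z] prob by (simp add: insert_UNIV)
    have upd [measurable]: "(\<lambda>(t, x). x(z := t)) \<in> measurable (N z \<Otimes>\<^sub>M ?I) ?P"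
      unfolding case_prod_unfold by (rule measurable_fun_upd[where J = "UNIV - {z}"]) auto
    \<comment> \<open>Since \<open>H\<close> ignores the coordinate \<open>z\<close>, the value 0
      placed there is arbitrary.\<close>
    define h where "h x = H (?c (x(z := 0)))" for x
    have fub: "(\<integral>\<^sup>+y. ennreal (f y) \<partial>distr ?P field_space ?c) =
        (\<integral>\<^sup>+x. \<integral>\<^sup>+t. ennreal (f (?c (x(z := t)))) \<partial>N z \<partial>?I)"
      if [measurable]: "f \<in> borel_measurable field_space" for f
    proof -
      define g where "g x = ennreal (f (?c x))" for x
      have [measurable]: "g \<in> borel_measurable ?P" unfolding g_def by measurable
      have "(\<integral>\<^sup>+y. ennreal (f y) \<partial>distr ?P field_space ?c) = (\<integral>\<^sup>+x. g x \<partial>?P)"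
        unfolding g_def by (subst nn_integral_distr) measurable
      also have "\<dots> = (\<integral>\<^sup>+p. g (case p of (t, x) \<Rightarrow> x(z := t)) \<partial>(N z \<Otimes>\<^sub>M ?I))"
        by (subst P, rule nn_integral_distr[OF upd]) measurable
      also have "\<dots> = (\<integral>\<^sup>+x. \<integral>\<^sup>+t. g (x(z := t)) \<partial>N z \<partial>?I)"
        using nn_integral_snd[of "\<lambda>p. g (case p of (t, x) \<Rightarrow> x(z := t))"] measurable_compose[OF upd] by simp
      finally show ?thesis unfolding g_def .
    qed
    have Hh: "H (?c (x(z := t))) = h x" for x t
      unfolding h_def by (rule ignoresD[OF ign]) auto
    have h0: "0 \<le> h x" for x by (simp add: h_def H0)
    have "(\<integral>\<^sup>+y. ennreal (exp (s * y z) * H y) \<partial>distr ?P field_space ?c) =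
       (\<integral>\<^sup>+x. \<integral>\<^sup>+t. ennreal (h x) * ennreal (exp (s * (t - (\<integral>x. x \<partial>N z)))) \<partial>N z \<partial>?I)"
      by (subst fub) (unfold Hh, simp_all add: h0 ennreal_mult mult.commute)
    also have "\<dots> = (\<integral>\<^sup>+x. ennreal (h x) * (\<integral>\<^sup>+t. ennreal (exp (s * (t - (\<integral>x. x \<partial>N z)))) \<partial>N z) \<partial>?I)"
      by (intro nn_integral_cong nn_integral_cmult) measurable
    also have "\<dots> \<le> (\<integral>\<^sup>+x. ennreal (h x) * ennreal (exp (s\<^sup>2 * K\<^sup>2 / 2)) \<partial>?I)"
      by (intro nn_integral_mono mult_left_mono hoeffding_centered prob sets bd) simp
    also have "\<dots> = ennreal (exp (s\<^sup>2 * K\<^sup>2 / 2)) * (\<integral>\<^sup>+x. ennreal (h x) \<partial>?I)"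
    proof -
      have "(\<lambda>x. x(z := 0)) \<in> measurable ?I ?P"
        using measurable_compose[OF measurable_Pair1'[of 0 "N z" ?I] upd] by (simp add: sets_eq_imp_space_eq[OF sets])
      then have [measurable]: "h \<in> borel_measurable ?I" unfolding h_def by measurable
      show ?thesis by (subst mult.commute, rule nn_integral_cmult) measurable
    qed
    also have "(\<integral>\<^sup>+x. ennreal (h x) \<partial>?I) = (\<integral>\<^sup>+y. ennreal (H y) \<partial>distr ?P field_space ?c)"
      by (subst fub) (unfold Hh, simp_all add: z.emeasure_space_1)
    finally show ?thesis .
  qed
  then show ?thesis by (simp add: subgaussian_field_def)
qed

section \<open>The conditional law of the weights given the environment\<close>

lemma field_kernel_measurable:
  fixes F :: "nat \<Rightarrow> 'w \<Rightarrow> real measure"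
  assumes F: "\<And>j. F j \<in> measurable M (prob_algebra borel)"
  shows "(\<lambda>\<omega>. PiM UNIV (\<lambda>z. F (snd z) \<omega>)) \<in> measurable M (prob_algebra field_space)"
proof (rule measurable_prob_algebra_generated[OF sets_PiM Int_stable_prod_algebra prod_algebra_sets_into_space])
  fix \<omega> assume \<omega>: "\<omega> \<in> space M"
  have Fp: "prob_space (F j \<omega>)" "sets (F j \<omega>) = sets borel" for j
    using measurable_space[OF F \<omega>] by (auto simp: space_prob_algebra)
  show "prob_space (PiM UNIV (\<lambda>z. F (snd z) \<omega>))" by (rule prob_space_PiM) (rule Fp)
  show "sets (PiM UNIV (\<lambda>z. F (snd z) \<omega>)) = sets field_space"
    by (rule sets_PiM_cong) (simp_all add: Fp)
next
  fix A :: "(nat \<times> nat \<Rightarrow> real) set" assume "A \<in> prod_algebra UNIV (\<lambda>_. borel)"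
  then obtain J E where A: "A = prod_emb UNIV (\<lambda>_. borel) J (\<Pi>\<^sub>E j\<in>J. E j)" "finite J"
    and E: "\<And>i. i \<in> J \<Longrightarrow> E i \<in> sets borel"
    by (rule prod_algebraE) blast
  \<comment> \<open>Cylinders form an intersection-stable generator, and on a cylinder the product
    measure is a finite product of functions measurable in the environment.\<close>
  have eq: "emeasure (PiM UNIV (\<lambda>z. F (snd z) \<omega>)) A = (\<Prod>z\<in>J. emeasure (F (snd z) \<omega>) (E z))"
    if \<omega>: "\<omega> \<in> space M" for \<omega>
  proof -
    have Fp: "prob_space (F j \<omega>)" "sets (F j \<omega>) = sets borel" for j
      using measurable_space[OF F \<omega>] by (auto simp: space_prob_algebra)
    have "A = prod_emb UNIV (\<lambda>z. F (snd z) \<omega>) J (\<Pi>\<^sub>E j\<in>J. E j)"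
      by (simp add: A(1) prod_emb_def sets_eq_imp_space_eq[OF Fp(2)])
    then show ?thesis using emeasure_PiM_emb[of UNIV "\<lambda>z. F (snd z) \<omega>" J E] A(2) E Fp by simp
  qed
  have [measurable]: "(\<lambda>\<omega>. emeasure (F (snd z) \<omega>) (E z)) \<in> borel_measurable M" if "z \<in> J" for z
    using measurable_emeasure_kernel[OF measurable_prob_algebraD[OF F] E[OF that]] .
  show "(\<lambda>\<omega>. emeasure (PiM UNIV (\<lambda>z. F (snd z) \<omega>)) A) \<in> borel_measurable M"
    by (subst measurable_cong[OF eq]) simp_all
qed

lemma env_algebra_measurable:
  assumes "\<And>j. F j \<in> measurable M (prob_algebra borel)"
  shows "(\<lambda>\<omega> j. F j \<omega>) \<in> measurable M (seq_space (prob_algebra borel))"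
  by (rule measurable_PiM_single') (use assms measurable_space[OF assms] in \<open>auto simp: space_PiM\<close>)

lemma subalgebra_env_algebra:
  assumes "\<And>j. F j \<in> measurable M (prob_algebra borel)"
  shows "subalgebra M (env_algebra M F)"
proof -
  have "\<And>A. A \<in> sets (seq_space (prob_algebra borel)) \<Longrightarrow>
      (\<lambda>\<omega> j. F j \<omega>) -` A \<inter> space M \<in> sets M"
    using env_algebra_measurable[of F M, OF assms] by (rule measurable_sets)
  moreover have "(\<lambda>\<omega> j. F j \<omega>) \<in> space M \<rightarrow> space (seq_space (prob_algebra borel))"
    using measurable_space[OF env_algebra_measurable[of F M, OF assms]] by auto
  ultimately show ?thesis
    unfolding subalgebra_def env_algebra_def by (auto simp: sets_vimage_algebra2)
qed

text \<open>Both sides integrate \<open>f\<close> against finite measures on fields: the law of the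
  weights on \<open>A\<close>, and the mixture of product measures over the environments in
  \<open>A\<close>. Cylinders determine such measures, and agreement on cylinders is the conditional
  product rule of \<open>weights_in_env\<close>.\<close>

lemma nn_integral_weights_in_env:
  fixes F :: "nat \<Rightarrow> 'w \<Rightarrow> real measure"
  assumes "prob_space M" and F: "\<And>j. F j \<in> measurable M (prob_algebra borel)"
    and X: "weights_in_env M F X" and A: "A \<in> sets (env_algebra M F)"
    and f: "f \<in> borel_measurable field_space"
  shows "(\<integral>\<^sup>+\<omega>. indicator A \<omega> * f (\<lambda>z. X z \<omega>) \<partial>M) =
    (\<integral>\<^sup>+\<omega>. indicator A \<omega> * (\<integral>\<^sup>+x. f x \<partial>PiM UNIV (\<lambda>z. F (snd z) \<omega>)) \<partial>M)"
proof -
  interpret prob_space M by fact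
  let ?E = "env_algebra M F"
  interpret finite_measure_subalgebra M ?E
    by unfold_locales (rule subalgebra_env_algebra[of F M, OF F])
  note [measurable] = f
  have AM [measurable]: "A \<in> sets M"
    using A subalgebra_env_algebra[of F M, OF F] by (auto simp: subalgebra_def)
  have Xm [measurable]: "X z \<in> borel_measurable M" for z
    using X unfolding weights_in_env_def by blast
  have Xs [measurable]: "(\<lambda>\<omega> z. X z \<omega>) \<in> measurable M field_space"
    by (rule measurable_PiM_single') (simp_all add: space_PiM)
  \<comment> \<open>Restricting \<open>M\<close> to \<open>A\<close> absorbs the indicator. Its
    total mass is \<open>prob A\<close>, so finiteness takes the place of normalization.\<close>
  define M' where "M' = density M (indicator A)"
  have [measurable_cong]: "sets M' = sets M" by (simp add: M'_def)
  have [simp]: "space M' = space M" by (simp add: M'_def)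
  define kern where "kern \<omega> = PiM (UNIV :: (nat \<times> nat) set) (\<lambda>z. F (snd z) \<omega> :: real measure)" for \<omega>
  have kM: "kern \<in> measurable M (subprob_algebra field_space)"
    unfolding kern_def by (rule measurable_prob_algebraD[OF field_kernel_measurable[OF F]])
  then have k [measurable]: "kern \<in> measurable M' (subprob_algebra field_space)"
    by (simp cong: measurable_cong_sets)
  have "distr M' field_space (\<lambda>\<omega> z. X z \<omega>) = M' \<bind> kern"
  proof (rule measure_eqI_PiM_infinite[where I = UNIV and M = "\<lambda>_. borel"])
    show "sets (distr M' field_space (\<lambda>\<omega> z. X z \<omega>)) = sets field_space" by simp
    show "sets (M' \<bind> kern) = sets field_space"
      by (rule sets_bind) (use sets_kernel[OF k] not_empty in auto)
    have "emeasure M' (space M') \<noteq> \<infinity>"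
      by (simp add: M'_def emeasure_density emeasure_eq_measure)
    then have "finite_measure M'" by (rule finite_measureI)
    then show "finite_measure (distr M' field_space (\<lambda>\<omega> z. X z \<omega>))"
      by (rule finite_measure.finite_measure_distr) measurable
  next
    fix B :: "nat \<times> nat \<Rightarrow> real set" and J assume J: "finite J" and B: "\<And>i. i \<in> J \<Longrightarrow> B i \<in> sets borel"
    let ?B = "prod_emb UNIV (\<lambda>_. borel) J (Pi\<^sub>E J B)"
    have Bm: "?B \<in> sets field_space"
      by (rule sets_PiM_I) (use J B in auto)
    define D where "D = {\<omega> \<in> space M. \<forall>z\<in>J. X z \<omega> \<in> B z}"
    have D: "(\<lambda>\<omega> z. X z \<omega>) -` ?B \<inter> space M = D"
      by (auto simp: D_def prod_emb_def restrict_PiE_iff)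
    then have Dm [measurable]: "D \<in> sets M"
      using measurable_sets[OF Xs Bm] by simp
    have AE: "AE \<omega> in M. real_cond_exp M ?E (indicat_real D) \<omega> = (\<Prod>z\<in>J. measure (F (snd z) \<omega>) (B z))"
      using X J B unfolding weights_in_env_def D_def by auto
    have mm [measurable]: "(\<lambda>\<omega>. measure (F (snd z) \<omega>) (B z)) \<in> borel_measurable M" if "z \<in> J" for z
      using measurable_compose[OF F measurable_measure_prob_algebra[OF B[OF that]]] .
    have pm [measurable]: "(\<lambda>\<omega>. \<Prod>z\<in>J. measure (F (snd z) \<omega>) (B z)) \<in> borel_measurable M"
      by (rule borel_measurable_prod) (rule mm)
    have le1: "(\<Prod>z\<in>J. measure (F (snd z) \<omega>) (B z)) \<le> 1" if "\<omega> \<in> space M" for \<omega>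
      using measurable_space[OF F that]
      by (intro prod_le_1) (auto simp: space_prob_algebra intro!: prob_space.prob_le_1)
    have "emeasure (distr M' field_space (\<lambda>\<omega> z. X z \<omega>)) ?B = emeasure M' D"
      using Bm D by (subst emeasure_distr) auto
    also have "\<dots> = emeasure M (A \<inter> D)"
      by (simp add: M'_def emeasure_density flip: indicator_inter_arith)
    also have "\<dots> = ennreal (\<integral>\<omega>\<in>A. indicat_real D \<omega> \<partial>M)"
      by (simp add: set_lebesgue_integral_def emeasure_eq_measure flip: indicator_inter_arith)
    \<comment> \<open>Here \<open>A\<close> has to be an event of the environment: conditional
      expectation preserves integrals over such events.\<close>
    also have "(\<integral>\<omega>\<in>A. indicat_real D \<omega> \<partial>M) = (\<integral>\<omega>\<in>A. real_cond_exp M ?E (indicat_real D) \<omega> \<partial>M)"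
      by (intro real_cond_exp_intA A integrable_const_bound[of _ 1]) auto
    also have "\<dots> = (\<integral>\<omega>\<in>A. (\<Prod>z\<in>J. measure (F (snd z) \<omega>) (B z)) \<partial>M)"
      unfolding set_lebesgue_integral_def
      by (rule integral_cong_AE) (use AE in \<open>auto\<close>)
    also have "ennreal \<dots> = (\<integral>\<^sup>+\<omega>. ennreal (indicator A \<omega> * (\<Prod>z\<in>J. measure (F (snd z) \<omega>) (B z))) \<partial>M)"
      unfolding set_lebesgue_integral_def real_scaleR_def
      by (rule nn_integral_eq_integral[symmetric])
         (auto intro!: integrable_const_bound[of _ 1] AE_I2 prod_nonneg simp: le1 abs_mult abs_prod indicator_def)
    also have "\<dots> = (\<integral>\<^sup>+\<omega>. indicator A \<omega> * emeasure (kern \<omega>) ?B \<partial>M)"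
    proof (rule nn_integral_cong)
      fix \<omega> assume \<omega>: "\<omega> \<in> space M"
      have Fp: "prob_space (F j \<omega>)" "sets (F j \<omega>) = sets borel" for j
        using measurable_space[OF F \<omega>] by (auto simp: space_prob_algebra)
      have "?B = prod_emb UNIV (\<lambda>z. F (snd z) \<omega>) J (\<Pi>\<^sub>E j\<in>J. B j)"
        by (simp add: prod_emb_def sets_eq_imp_space_eq[OF Fp(2)])
      then have "emeasure (kern \<omega>) ?B = (\<Prod>z\<in>J. emeasure (F (snd z) \<omega>) (B z))"
        using emeasure_PiM_emb[of UNIV "\<lambda>z. F (snd z) \<omega>" J B] J B Fp by (simp add: kern_def)
      also have "\<dots> = ennreal (\<Prod>z\<in>J. measure (F (snd z) \<omega>) (B z))"
        using prob_space.finite_measure[OF Fp(1), THEN finite_measure.emeasure_eq_measure]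
        by (simp add: prod_ennreal)
      finally show "ennreal (indicator A \<omega> * (\<Prod>z\<in>J. measure (F (snd z) \<omega>) (B z))) =
          indicator A \<omega> * emeasure (kern \<omega>) ?B"
        by (simp add: indicator_def)
    qed
    also have "\<dots> = (\<integral>\<^sup>+\<omega>. emeasure (kern \<omega>) ?B \<partial>M')"
      unfolding M'_def using measurable_emeasure_kernel[OF kM Bm] by (subst nn_integral_density) auto
    also have "\<dots> = emeasure (M' \<bind> kern) ?B"
      using emeasure_bind[OF _ k Bm] not_empty by simp
    finally show "emeasure (distr M' field_space (\<lambda>\<omega> z. X z \<omega>)) ?B = emeasure (M' \<bind> kern) ?B" .
  qed
  then have "(\<integral>\<^sup>+x. f x \<partial>distr M' field_space (\<lambda>\<omega> z. X z \<omega>)) = (\<integral>\<^sup>+x. f x \<partial>(M' \<bind> kern))"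
    by simp
  moreover have "(\<integral>\<^sup>+x. f x \<partial>distr M' field_space (\<lambda>\<omega> z. X z \<omega>)) = (\<integral>\<^sup>+\<omega>. f (\<lambda>z. X z \<omega>) \<partial>M')"
    by (rule nn_integral_distr) measurable
  moreover have "\<dots> = (\<integral>\<^sup>+\<omega>. indicator A \<omega> * f (\<lambda>z. X z \<omega>) \<partial>M)"
    unfolding M'_def using measurable_compose[OF Xs f] by (subst nn_integral_density) auto
  moreover have "(\<integral>\<^sup>+x. f x \<partial>(M' \<bind> kern)) = (\<integral>\<^sup>+\<omega>. \<integral>\<^sup>+x. f x \<partial>kern \<omega> \<partial>M')"
    by (rule nn_integral_bind[OF f k])
  moreover have "\<dots> = (\<integral>\<^sup>+\<omega>. indicator A \<omega> * (\<integral>\<^sup>+x. f x \<partial>kern \<omega>) \<partial>M)"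
    unfolding M'_def
    using measurable_compose[OF kM nn_integral_measurable_subprob_algebra[OF f]] by (subst nn_integral_density) auto
  ultimately show ?thesis unfolding kern_def by simp
qed

section \<open>Bounds on the passage time\<close>

lemma last_passage_obtain:
  obtains p where "p \<in> lattice_paths k l" "last_passage x k l = (\<Sum>z\<leftarrow>butlast p. x z)"
proof -
  have "last_passage x k l \<in> (\<lambda>p. \<Sum>z\<leftarrow>butlast p. x z) ` lattice_paths k l"
    unfolding last_passage_def
    by (intro Max_in finite_imageI finite_lattice_paths) (simp add: lattice_paths_nonempty)
  then show ?thesis using that by auto
qed

lemma length_butlast_lattice_path: "p \<in> lattice_paths k l \<Longrightarrow> length (butlast p) = k + l"
  using lattice_path_coords[of p] by (auto simp: lattice_paths_def)

lemma abs_last_passage_le: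
  assumes "\<And>z. \<bar>x z\<bar> \<le> K"
  shows "\<bar>last_passage x k l\<bar> \<le> real (k + l) * K"
proof -
  obtain p where p: "p \<in> lattice_paths k l" and eq: "last_passage x k l = (\<Sum>z\<leftarrow>butlast p. x z)"
    by (rule last_passage_obtain)
  have "\<bar>\<Sum>z\<leftarrow>butlast p. x z\<bar> \<le> (\<Sum>z\<leftarrow>butlast p. \<bar>x z\<bar>)"
    using sum_list_abs[of "map x (butlast p)"] by (simp add: comp_def)
  also have "\<dots> \<le> (\<Sum>z\<leftarrow>butlast p. K)"
    by (rule sum_list_mono) (rule assms)
  also have "\<dots> = real (k + l) * K"
    by (simp add: sum_list_triv length_butlast_lattice_path[OF p] del: length_butlast)
  finally show ?thesis unfolding eq .
qed

lemma last_passage_ge_corner: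
  "(\<Sum>i<k. x (i, 0)) + (\<Sum>j<l. x (k, j)) \<le> last_passage x k l"
proof -
  \<comment> \<open>The list contains the endpoint, hence \<open>Suc l\<close>;
    \<open>butlast\<close> drops it again below.\<close>
  define p where "p = map (\<lambda>i. (i, 0 :: nat)) [0..<k] @ map (\<lambda>j. (k, j)) [0..<Suc l]"
  have "successively lattice_step p"
    unfolding successively_conv_nth p_def
  proof (intro allI impI)
    fix i assume i: "Suc i < length (map (\<lambda>i. (i, 0 :: nat)) [0..<k] @ map (\<lambda>j. (k, j)) [0..<Suc l])"
    consider "Suc i < k" | "Suc i = k" | "k \<le> i" by linarith
    then show "lattice_step ((map (\<lambda>i. (i, 0 :: nat)) [0..<k] @ map (\<lambda>j. (k, j)) [0..<Suc l]) ! i)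
        ((map (\<lambda>i. (i, 0 :: nat)) [0..<k] @ map (\<lambda>j. (k, j)) [0..<Suc l]) ! Suc i)"
      using i by cases (auto simp: nth_append lattice_step_def simp del: upt_Suc)
  qed
  moreover have "hd p = (0, 0)"
    by (cases k) (simp_all add: p_def hd_append upt_conv_Cons del: upt_Suc)
  moreover have "last p = (k, l)" "p \<noteq> []"
    by (simp_all add: p_def)
  ultimately have p: "p \<in> lattice_paths k l" by (simp add: lattice_paths_def)
  have "butlast p = map (\<lambda>i. (i, 0 :: nat)) [0..<k] @ map (\<lambda>j. (k, j)) [0..<l]"
    by (simp add: p_def butlast_append)
  then have "(\<Sum>z\<leftarrow>butlast p. x z) = (\<Sum>i<k. x (i, 0)) + (\<Sum>j<l. x (k, j))"
    by (simp add: comp_def interv_sum_list_conv_sum_set_nat atLeast0LessThan)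
  moreover have "(\<Sum>z\<leftarrow>butlast p. x z) \<le> last_passage x k l"
    unfolding last_passage_def by (intro Max_ge finite_imageI finite_lattice_paths imageI p)
  ultimately show ?thesis by simp
qed

lemma measurable_last_passage [measurable]:
  "(\<lambda>x. last_passage x k l) \<in> borel_measurable field_space"
proof -
  have "(\<lambda>x. \<Sum>z\<leftarrow>ps. x z) \<in> borel_measurable field_space" for ps :: "(nat \<times> nat) list"
    by (induction ps) simp_all
  then show ?thesis
    unfolding last_passage_def by (intro borel_measurable_Max finite_lattice_paths)
qed

text \<open>Every path to \<open>(n, k)\<close> collects exactly \<open>n + k\<close> sites, so
  replacing the means by their bound \<open>\<mu>\<close> subtracts the same amount from all paths.
  The maximizing path is then estimated with centered weights.\<close>

lemma exp_last_passage_le: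
  assumes "0 < L" "0 \<le> l" and m: "\<And>z. m z \<le> \<mu>"
  shows "exp (l * (last_passage x n k - real (n + k) * \<mu>))
    \<le> coarse_partition l L (\<lambda>z. x z - m z) (Suc k) (n div L)"
proof -
  obtain p where p: "p \<in> lattice_paths n k" and eq: "last_passage x n k = (\<Sum>z\<leftarrow>butlast p. x z)"
    by (rule last_passage_obtain)
  have "(\<Sum>z\<leftarrow>butlast p. m z) \<le> (\<Sum>z\<leftarrow>butlast p. \<mu>)"
    by (rule sum_list_mono) (rule m)
  also have "\<dots> = real (n + k) * \<mu>"
    by (simp add: sum_list_triv length_butlast_lattice_path[OF p] del: length_butlast)
  finally have "last_passage x n k - real (n + k) * \<mu> \<le> (\<Sum>z\<leftarrow>butlast p. x z - m z)"
    unfolding eq sum_list_subtractf by simp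
  then have "exp (l * (last_passage x n k - real (n + k) * \<mu>)) \<le> exp (l * (\<Sum>z\<leftarrow>butlast p. x z - m z))"
    using assms(2) by (simp add: mult_left_mono)
  also have "\<dots> \<le> coarse_partition l L (\<lambda>z. x z - m z) (Suc k) (n div L)"
    by (rule exp_path_le_coarse_partition[OF assms(1,2) p])
  finally show ?thesis .
qed

text \<open>The environment is frozen here. The bound depends on it only through \<open>K\<close>
  and \<open>\<mu>\<close>, so it survives averaging over the environment.\<close>

lemma nn_integral_exp_last_passage_le:
  fixes N :: "nat \<times> nat \<Rightarrow> real measure"
  assumes prob: "\<And>z. prob_space (N z)" and sets: "\<And>z. sets (N z) = sets borel"
    and bd: "\<And>z. AE x in N z. x \<in> {-K..K}" and mean: "\<And>z. (\<integral>x. x \<partial>N z) \<le> \<mu>"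
    and "0 < L" "0 \<le> l" and q: "q = exp (2 * l\<^sup>2 * K\<^sup>2 * L)"
  shows "(\<integral>\<^sup>+x. ennreal (exp (l * (last_passage x n k - real (n + k) * \<mu>))) \<partial>PiM UNIV N)
    \<le> ennreal ((4 * q) ^ Suc k * (2 * q) ^ (n div L))"
proof -
  note [measurable_cong] = sets
  let ?c = "\<lambda>x z. x z - (\<integral>x. x \<partial>N z)"
  have [measurable_cong]: "sets (PiM UNIV N) = sets field_space"
    by (rule sets_PiM_cong) (simp_all add: sets)
  have c [measurable]: "?c \<in> measurable (PiM UNIV N) field_space"
    by (rule measurable_PiM_single') (simp_all add: space_PiM)
  interpret P: prob_space "PiM UNIV N" by (rule prob_space_PiM) (rule prob)
  have "(\<integral>\<^sup>+x. ennreal (exp (l * (last_passage x n k - real (n + k) * \<mu>))) \<partial>PiM UNIV N) \<le>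
      (\<integral>\<^sup>+x. ennreal (coarse_partition l L (?c x) (Suc k) (n div L)) \<partial>PiM UNIV N)"
    by (intro nn_integral_mono ennreal_leI exp_last_passage_le assms)
  also have "\<dots> = (\<integral>\<^sup>+y. ennreal (coarse_partition l L y (Suc k) (n div L)) \<partial>distr (PiM UNIV N) field_space ?c)"
    by (rule nn_integral_distr[symmetric]) measurable
  also have "\<dots> \<le> ennreal ((4 * q) ^ Suc k * (2 * q) ^ (n div L))"
    by (intro nn_integral_coarse_partition_le[OF subgaussian_field_centered_PiM[where K = K]] P.prob_space_distr prob sets bd c q)
  finally show ?thesis .
qed

lemma nn_integral_PiM_component:
  assumes "\<And>z. prob_space (N z)" and f: "f \<in> borel_measurable (N z)"
  shows "(\<integral>\<^sup>+x. f (x z) \<partial>PiM UNIV N) = (\<integral>\<^sup>+t. f t \<partial>N z)"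
proof -
  interpret product_prob_space N UNIV
    by (intro product_prob_spaceI assms)
  have "(\<integral>\<^sup>+t. f t \<partial>N z) = (\<integral>\<^sup>+t. f t \<partial>distr (PiM UNIV N) (N z) (\<lambda>x. x z))"
    by (simp add: PiM_component)
  also have "\<dots> = (\<integral>\<^sup>+x. f (x z) \<partial>PiM UNIV N)"
    by (rule nn_integral_distr) (use f in auto)
  finally show ?thesis by simp
qed

section \<open>Means of laws supported in a bounded interval\<close>

context
  fixes G :: "real measure" and K :: real
  assumes prob: "prob_space G" and sets: "sets G = sets borel" and bd: "AE x in G. x \<in> {-K..K}"
begin

lemma integrable_bounded_support: "integrable G (\<lambda>x. x)"
proof -
  interpret prob_space G by (rule prob)
  note [measurable_cong] = sets
  show ?thesis by (rule integrable_const_bound[of _ K]) (use bd in auto)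
qed

lemma abs_dist_mean_le: "\<bar>dist_mean G\<bar> \<le> K"
proof -
  interpret prob_space G by (rule prob)
  have "\<bar>dist_mean G\<bar> \<le> (\<integral>x. \<bar>x\<bar> \<partial>G)"
    unfolding dist_mean_def using integral_norm_bound[of G "\<lambda>x. x"] by simp
  also have "\<dots> \<le> K"
    by (rule integral_le_const) (use integrable_bounded_support bd in auto)
  finally show ?thesis .
qed

text \<open>The shift by \<open>K\<close> makes the variable nonnegative on the support, so that
  means can be computed by the disintegration for nonnegative functions.\<close>

lemma nn_integral_add_dist_mean: "(\<integral>\<^sup>+t. ennreal (t + K) \<partial>G) = ennreal (dist_mean G + K)"
proof -
  interpret prob_space G by (rule prob)
  have "(\<integral>\<^sup>+t. ennreal (t + K) \<partial>G) = ennreal (\<integral>t. t + K \<partial>G)"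
    by (rule nn_integral_eq_integral) (use integrable_bounded_support bd in auto)
  also have "(\<integral>t. t + K \<partial>G) = dist_mean G + K"
    unfolding dist_mean_def using integrable_bounded_support by (simp add: prob_space)
  finally show ?thesis .
qed

end

section \<open>Expected passage times and their limits in a bounded environment\<close>

locale bounded_environment = prob_space M for M :: "'w measure" +
  fixes F :: "nat \<Rightarrow> 'w \<Rightarrow> real measure" and X :: "nat \<times> nat \<Rightarrow> 'w \<Rightarrow> real" and K \<mu> :: real
  assumes F: "\<And>j. F j \<in> measurable M (prob_algebra borel)"
    and X: "weights_in_env M F X"
    and K: "0 < K"
    and bounded: "\<And>j. AE \<omega> in M. AE x in F j \<omega>. x \<in> {-K..K}"
    and mean_le: "\<And>j. AE \<omega> in M. dist_mean (F j \<omega>) \<le> \<mu>"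
begin

lemma prob_F: "\<omega> \<in> space M \<Longrightarrow> prob_space (F j \<omega>)"
  and sets_F: "\<omega> \<in> space M \<Longrightarrow> sets (F j \<omega>) = sets borel"
  using measurable_space[OF F] by (auto simp: space_prob_algebra)

lemma measurable_X [measurable]: "X z \<in> borel_measurable M"
  using X unfolding weights_in_env_def by blast

lemma measurable_X_field [measurable]: "(\<lambda>\<omega> z. X z \<omega>) \<in> measurable M field_space"
  by (rule measurable_PiM_single') (simp_all add: space_PiM)

lemma measurable_passage [measurable]: "(\<lambda>\<omega>. last_passage (\<lambda>z. X z \<omega>) n k) \<in> borel_measurable M"
  using measurable_compose[OF measurable_X_field measurable_last_passage] .

lemma measurable_dist_mean [measurable]: "(\<lambda>\<omega>. dist_mean (F j \<omega>)) \<in> borel_measurable M"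
  unfolding dist_mean_def
  by (rule measurable_compose[OF measurable_prob_algebraD[OF F] integral_measurable_subprob_algebra]) simp

lemma nn_integral_component:
  assumes A: "A \<in> sets (env_algebra M F)" and f [measurable]: "f \<in> borel_measurable borel"
  shows "(\<integral>\<^sup>+\<omega>. indicator A \<omega> * f (X z \<omega>) \<partial>M) = (\<integral>\<^sup>+\<omega>. indicator A \<omega> * (\<integral>\<^sup>+t. f t \<partial>F (snd z) \<omega>) \<partial>M)"
proof -
  have "(\<integral>\<^sup>+\<omega>. indicator A \<omega> * f (X z \<omega>) \<partial>M) =
      (\<integral>\<^sup>+\<omega>. indicator A \<omega> * (\<integral>\<^sup>+x. f (x z) \<partial>PiM UNIV (\<lambda>z. F (snd z) \<omega>)) \<partial>M)"
    by (rule nn_integral_weights_in_env[where f = "\<lambda>x. f (x z)"]) (use A F X prob_space_axioms in measurable)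
  also have "\<dots> = (\<integral>\<^sup>+\<omega>. indicator A \<omega> * (\<integral>\<^sup>+t. f t \<partial>F (snd z) \<omega>) \<partial>M)"
  proof (rule nn_integral_cong)
    fix \<omega> assume \<omega>: "\<omega> \<in> space M"
    have "f \<in> borel_measurable (F (snd z) \<omega>)"
      using f measurable_cong_sets[OF sets_F[OF \<omega>] refl] by blast
    then show "indicator A \<omega> * (\<integral>\<^sup>+x. f (x z) \<partial>PiM UNIV (\<lambda>z. F (snd z) \<omega>)) =
        indicator A \<omega> * (\<integral>\<^sup>+t. f t \<partial>F (snd z) \<omega>)"
      using nn_integral_PiM_component[of "\<lambda>z. F (snd z) \<omega>" f z] prob_F[OF \<omega>] by simp
  qed
  finally show ?thesis .
qed

lemma space_env: "space M \<in> sets (env_algebra M F)"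
  using sets.top[of "env_algebra M F"] by (simp add: env_algebra_def)

text \<open>The disintegration is applied to the indicator of the complement of the interval, whose
  conditional probability vanishes for almost every environment.\<close>

lemma X_bounded: "AE \<omega> in M. \<bar>X z \<omega>\<bar> \<le> K"
proof -
  have "(\<integral>\<^sup>+\<omega>. indicator (- {-K..K}) (X z \<omega>) \<partial>M) =
      (\<integral>\<^sup>+\<omega>. indicator (space M) \<omega> * indicator (- {-K..K}) (X z \<omega>) \<partial>M)"
    by (intro nn_integral_cong) simp
  also have "\<dots> = (\<integral>\<^sup>+\<omega>. indicator (space M) \<omega> * (\<integral>\<^sup>+t. indicator (- {-K..K}) t \<partial>F (snd z) \<omega>) \<partial>M)"
    by (rule nn_integral_component[OF space_env]) measurable
  also have "\<dots> = (\<integral>\<^sup>+\<omega>. 0 \<partial>M)"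
  proof (rule nn_integral_cong_AE)
    show "AE \<omega> in M. indicator (space M) \<omega> * (\<integral>\<^sup>+t. indicator (- {-K..K}) t \<partial>F (snd z) \<omega>) = 0"
      using bounded[of "snd z"]
    proof eventually_elim
      case (elim \<omega>)
      then have "AE t in F (snd z) \<omega>. indicator (- {-K..K}) t = (0 :: ennreal)"
        by eventually_elim auto
      then have "(\<integral>\<^sup>+t. indicator (- {-K..K}) t \<partial>F (snd z) \<omega>) = (\<integral>\<^sup>+t. 0 \<partial>F (snd z) \<omega>)"
        by (rule nn_integral_cong_AE)
      then show ?case by simp
    qed
  qed
  finally have "(\<integral>\<^sup>+\<omega>. indicator (- {-K..K}) (X z \<omega>) \<partial>M) = 0" by simp
  then have "AE \<omega> in M. indicator (- {-K..K}) (X z \<omega>) = (0 :: ennreal)"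
    by (subst (asm) nn_integral_0_iff_AE) auto
  then show ?thesis
    by eventually_elim (auto simp: indicator_def split: if_splits)
qed

lemma dist_mean_bounded: "AE \<omega> in M. \<bar>dist_mean (F j \<omega>)\<bar> \<le> K"
  using bounded[of j] AE_space by eventually_elim (rule abs_dist_mean_le[OF prob_F sets_F]; assumption)

lemma nn_integral_shift: "AE \<omega> in M. (\<integral>\<^sup>+t. ennreal (t + K) \<partial>F j \<omega>) = ennreal (dist_mean (F j \<omega>) + K)"
  using bounded[of j] AE_space by eventually_elim (rule nn_integral_add_dist_mean[OF prob_F sets_F]; assumption)

lemma integrable_X: "integrable M (X z)"
  by (rule integrable_const_bound[of _ K]) (use X_bounded[of z] in auto)

lemma integrable_dist_mean: "integrable M (\<lambda>\<omega>. dist_mean (F j \<omega>))"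
  by (rule integrable_const_bound[of _ K]) (use dist_mean_bounded[of j] in auto)

lemma env_events: "A \<in> sets (env_algebra M F) \<Longrightarrow> A \<in> sets M"
  using subalgebra_env_algebra[of F M, OF F] by (auto simp: subalgebra_def)

text \<open>The identity is first obtained for the almost surely nonnegative variable
  \<open>X z + K\<close>; subtracting the integrable shift gives the signed version.\<close>

lemma expectation_component:
  assumes A: "A \<in> sets (env_algebra M F)"
  shows "(\<integral>\<omega>. indicator A \<omega> * X z \<omega> \<partial>M) = (\<integral>\<omega>. indicator A \<omega> * dist_mean (F (snd z) \<omega>) \<partial>M)"
proof -
  note [measurable] = env_events[OF A]
  have "(\<integral>\<^sup>+\<omega>. ennreal (indicator A \<omega> * (X z \<omega> + K)) \<partial>M) = (\<integral>\<^sup>+\<omega>. indicator A \<omega> * ennreal (X z \<omega> + K) \<partial>M)"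
    by (intro nn_integral_cong) (simp add: indicator_def)
  also have "\<dots> = (\<integral>\<^sup>+\<omega>. indicator A \<omega> * (\<integral>\<^sup>+t. ennreal (t + K) \<partial>F (snd z) \<omega>) \<partial>M)"
    by (rule nn_integral_component[OF A]) measurable
  also have "\<dots> = (\<integral>\<^sup>+\<omega>. ennreal (indicator A \<omega> * (dist_mean (F (snd z) \<omega>) + K)) \<partial>M)"
    by (rule nn_integral_cong_AE, use nn_integral_shift[of "snd z"] in eventually_elim) (simp add: indicator_def)
  finally have nn: "(\<integral>\<^sup>+\<omega>. ennreal (indicator A \<omega> * (X z \<omega> + K)) \<partial>M) =
      (\<integral>\<^sup>+\<omega>. ennreal (indicator A \<omega> * (dist_mean (F (snd z) \<omega>) + K)) \<partial>M)" .
  have "(\<integral>\<omega>. indicator A \<omega> * (X z \<omega> + K) \<partial>M) = enn2real (\<integral>\<^sup>+\<omega>. ennreal (indicator A \<omega> * (X z \<omega> + K)) \<partial>M)"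
  proof (rule integral_eq_nn_integral)
    show "AE \<omega> in M. 0 \<le> indicator A \<omega> * (X z \<omega> + K)"
      using X_bounded[of z] by eventually_elim (auto simp: indicator_def abs_le_iff)
  qed measurable
  also have "\<dots> = (\<integral>\<omega>. indicator A \<omega> * (dist_mean (F (snd z) \<omega>) + K) \<partial>M)"
    unfolding nn
  proof (rule integral_eq_nn_integral[symmetric])
    show "AE \<omega> in M. 0 \<le> indicator A \<omega> * (dist_mean (F (snd z) \<omega>) + K)"
      using dist_mean_bounded[of "snd z"] by eventually_elim (auto simp: indicator_def abs_le_iff)
  qed measurable
  finally have "(\<integral>\<omega>. indicator A \<omega> * X z \<omega> + indicator A \<omega> * K \<partial>M) =
      (\<integral>\<omega>. indicator A \<omega> * dist_mean (F (snd z) \<omega>) + indicator A \<omega> * K \<partial>M)"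
    by (simp add: distrib_left)
  moreover have "integrable M (\<lambda>\<omega>. indicator A \<omega> * X z \<omega>)"
    "integrable M (\<lambda>\<omega>. indicator A \<omega> * dist_mean (F (snd z) \<omega>))"
    "integrable M (\<lambda>\<omega>. indicator A \<omega> * K)"
    using integrable_mult_indicator[OF env_events[OF A] integrable_X]
      integrable_mult_indicator[OF env_events[OF A] integrable_dist_mean]
      integrable_mult_indicator[OF env_events[OF A], of "\<lambda>_. K"] by simp_all
  ultimately show ?thesis by simp
qed

lemma passage_bounded: "AE \<omega> in M. \<bar>last_passage (\<lambda>z. X z \<omega>) n k\<bar> \<le> real (n + k) * K"
proof -
  have "AE \<omega> in M. \<forall>z. \<bar>X z \<omega>\<bar> \<le> K"
    unfolding AE_all_countable by (intro allI X_bounded)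
  then show ?thesis by eventually_elim (intro abs_last_passage_le, auto)
qed

lemma integrable_passage: "integrable M (\<lambda>\<omega>. last_passage (\<lambda>z. X z \<omega>) n k)"
  by (rule integrable_const_bound[of _ "real (n + k) * K"]) (use passage_bounded in auto)

text \<open>Jensen's inequality turns the bound \<open>B\<close> on the exponential moment into the
  bound \<open>ln B / l\<close> on the centered expectation.\<close>

lemma expectation_passage_le:
  assumes "0 < L" "0 < l" and q: "q = exp (2 * l\<^sup>2 * K\<^sup>2 * L)"
  shows "expectation (\<lambda>\<omega>. last_passage (\<lambda>z. X z \<omega>) n k)
    \<le> real (n + k) * \<mu> + real (Suc k + n div L) * ln (4 * q) / l"
proof -
  let ?T = "\<lambda>\<omega>. last_passage (\<lambda>z. X z \<omega>) n k"
  define B where "B = (4 * q) ^ Suc k * (2 * q) ^ (n div L)"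
  define f where "f x = ennreal (exp (l * (last_passage x n k - real (n + k) * \<mu>)))" for x
  have [measurable]: "f \<in> borel_measurable field_space" unfolding f_def by measurable
  have q0: "1 \<le> q" by (simp add: q)
  then have B0: "0 < B" by (simp add: B_def)
  have "(\<integral>\<^sup>+\<omega>. f (\<lambda>z. X z \<omega>) \<partial>M) = (\<integral>\<^sup>+\<omega>. indicator (space M) \<omega> * f (\<lambda>z. X z \<omega>) \<partial>M)"
    by (intro nn_integral_cong) simp
  also have "\<dots> = (\<integral>\<^sup>+\<omega>. indicator (space M) \<omega> * (\<integral>\<^sup>+x. f x \<partial>PiM UNIV (\<lambda>z. F (snd z) \<omega>)) \<partial>M)"
    by (rule nn_integral_weights_in_env[OF prob_space_axioms F X space_env]) measurable
  also have "\<dots> \<le> (\<integral>\<^sup>+\<omega>. ennreal B \<partial>M)"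
  proof (rule nn_integral_mono_AE)
    have "AE \<omega> in M. \<forall>j. AE x in F j \<omega>. x \<in> {-K..K}"
      unfolding AE_all_countable by (intro allI bounded)
    moreover have "AE \<omega> in M. \<forall>j. dist_mean (F j \<omega>) \<le> \<mu>"
      unfolding AE_all_countable by (intro allI mean_le)
    ultimately show "AE \<omega> in M. indicator (space M) \<omega> * (\<integral>\<^sup>+x. f x \<partial>PiM UNIV (\<lambda>z. F (snd z) \<omega>)) \<le> ennreal B"
      using AE_space
    proof eventually_elim
      case (elim \<omega>)
      have "(\<integral>\<^sup>+x. f x \<partial>PiM UNIV (\<lambda>z. F (snd z) \<omega>)) \<le> ennreal B"
        unfolding f_def B_def
        by (rule nn_integral_exp_last_passage_le[where K = K, OF _ _ _ _ assms(1) less_imp_le[OF assms(2)] q])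
           (use elim in \<open>auto simp: prob_F sets_F dist_mean_def\<close>)
      then show ?case using elim by simp
    qed
  qed
  finally have nn: "(\<integral>\<^sup>+\<omega>. f (\<lambda>z. X z \<omega>) \<partial>M) \<le> ennreal B"
    by (simp add: emeasure_space_1)
  define g where "g \<omega> = exp (l * (?T \<omega> - real (n + k) * \<mu>))" for \<omega>
  have [measurable]: "g \<in> borel_measurable M" unfolding g_def by measurable
  have gB: "(\<integral>\<^sup>+\<omega>. ennreal (g \<omega>) \<partial>M) \<le> ennreal B" using nn by (simp add: f_def g_def)
  have g: "integrable M g"
    using gB by (intro integrableI_nonneg) (auto simp: g_def intro: le_less_trans)
  have "expectation g \<le> B"
    using gB B0 by (subst integral_eq_nn_integral) (auto simp: g_def intro: enn2real_leI)
  \<comment> \<open>Jensen's inequality in tangent form, \<open>1 + v \<le> exp v\<close>.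
    Subtracting \<open>ln B\<close> in \<open>v\<close> makes the expectation of the right-hand side
    at most 1.\<close>
  have "expectation (\<lambda>\<omega>. 1 + (l * (?T \<omega> - real (n + k) * \<mu>) - ln B)) \<le> expectation (\<lambda>\<omega>. g \<omega> / B)"
  proof (rule integral_mono)
    fix \<omega>
    have "1 + (l * (?T \<omega> - real (n + k) * \<mu>) - ln B) \<le> exp (l * (?T \<omega> - real (n + k) * \<mu>) - ln B)"
      by (rule exp_ge_add_one_self)
    then show "1 + (l * (?T \<omega> - real (n + k) * \<mu>) - ln B) \<le> g \<omega> / B"
      using B0 by (simp add: g_def exp_diff)
  qed (use g integrable_passage in auto)
  also have "\<dots> \<le> 1" using \<open>expectation g \<le> B\<close> B0 by simp
  also have "expectation (\<lambda>\<omega>. 1 + (l * (?T \<omega> - real (n + k) * \<mu>) - ln B)) =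
      1 + (l * (expectation ?T - real (n + k) * \<mu>) - ln B)"
    using integrable_passage[of n k] by (simp add: prob_space)
  finally have "expectation ?T \<le> real (n + k) * \<mu> + ln B / l"
    using assms(2) by (simp add: field_simps)
  \<comment> \<open>Enlarging \<open>2 * q\<close> to \<open>4 * q\<close> gives all factors the
    same base.\<close>
  also have "ln B \<le> real (Suc k + n div L) * ln (4 * q)"
  proof -
    have "B \<le> (4 * q) ^ Suc k * (4 * q) ^ (n div L)"
      unfolding B_def using q0 by (intro mult_left_mono power_mono) auto
    also have "\<dots> = (4 * q) ^ (Suc k + n div L)" by (simp add: power_add)
    finally have "ln B \<le> ln ((4 * q) ^ (Suc k + n div L))" using B0 by (intro ln_mono) auto
    then show ?thesis using q0 by (subst (asm) ln_realpow) auto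
  qed
  then have "real (n + k) * \<mu> + ln B / l \<le> real (n + k) * \<mu> + real (Suc k + n div L) * ln (4 * q) / l"
    using assms(2) by (intro add_left_mono divide_right_mono) auto
  finally show ?thesis .
qed

text \<open>The sites of the corner path are averaged over \<open>A\<close> one by one. By
  \<open>expectation_component\<close>, a site of the horizontal stretch contributes at least
  \<open>prob A * c\<close> and a site of the vertical one at least
  \<open>prob A * (- K)\<close>.\<close>

lemma expectation_passage_ge:
  assumes A: "A \<in> sets (env_algebra M F)" and c: "\<And>\<omega>. \<omega> \<in> A \<Longrightarrow> c \<le> dist_mean (F 0 \<omega>)"
  shows "prob A * (real n * c - real k * K) \<le> (\<integral>\<omega>. indicator A \<omega> * last_passage (\<lambda>z. X z \<omega>) n k \<partial>M)"
proof -
  have AM [measurable]: "A \<in> sets M" by (rule env_events[OF A])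
  note int = integrable_mult_indicator[OF AM integrable_X] integrable_mult_indicator[OF AM integrable_passage]
     integrable_mult_indicator[OF AM integrable_dist_mean]
  have cst: "(\<integral>\<omega>. indicator A \<omega> * r \<partial>M) = prob A * r" "integrable M (\<lambda>\<omega>. indicator A \<omega> * r)" for r :: real
    using integrable_mult_indicator[OF AM, of "\<lambda>_. r"] by simp_all
  have 0: "prob A * c \<le> (\<integral>\<omega>. indicator A \<omega> * X (i, 0) \<omega> \<partial>M)" for i
    unfolding expectation_component[OF A] cst(1)[symmetric]
    by (rule integral_mono) (use cst(2) int c in \<open>auto simp: indicator_def\<close>)
  have j: "prob A * (- K) \<le> (\<integral>\<omega>. indicator A \<omega> * X (i, j) \<omega> \<partial>M)" for i j
    unfolding expectation_component[OF A] cst(1)[symmetric]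
  proof (rule integral_mono_AE)
    show "AE \<omega> in M. indicator A \<omega> * - K \<le> indicator A \<omega> * dist_mean (F (snd (i, j)) \<omega>)"
      using dist_mean_bounded[of j] by eventually_elim (auto simp: indicator_def abs_le_iff)
  qed (use cst(2) int in auto)
  define Z where "Z z \<omega> = indicator A \<omega> * X z \<omega>" for z \<omega>
  have Z: "integrable M (Z z)" for z using int(1)[of z] by (simp add: Z_def[abs_def])
  have "prob A * (real n * c - real k * K) = (\<Sum>i<n. prob A * c) + (\<Sum>j<k. prob A * (- K))"
    by (simp add: algebra_simps)
  also have "\<dots> \<le> (\<Sum>i<n. expectation (Z (i, 0))) + (\<Sum>j<k. expectation (Z (n, j)))"
    unfolding Z_def by (intro add_mono sum_mono 0 j)
  also have "\<dots> = (\<integral>\<omega>. (\<Sum>i<n. Z (i, 0) \<omega>) + (\<Sum>j<k. Z (n, j) \<omega>) \<partial>M)"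
    using Z by (simp add: Bochner_Integration.integral_sum)
  also have "\<dots> \<le> (\<integral>\<omega>. indicator A \<omega> * last_passage (\<lambda>z. X z \<omega>) n k \<partial>M)"
  proof (rule integral_mono)
    fix \<omega>
    show "(\<Sum>i<n. Z (i, 0) \<omega>) + (\<Sum>j<k. Z (n, j) \<omega>) \<le> indicator A \<omega> * last_passage (\<lambda>z. X z \<omega>) n k"
      using last_passage_ge_corner[where x = "\<lambda>z. X z \<omega>" and k = n and l = k]
      by (cases "\<omega> \<in> A") (simp_all add: Z_def)
  qed (use Z int in auto)
  finally show ?thesis .
qed

text \<open>Dominated convergence. As the limit is deterministic, averages over any event
  \<open>A\<close> recover the same \<open>\<psi>\<close>: the upper bound takes the whole space,
  the lower bound an event on which row 0 is favorable.\<close>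

lemma tendsto_expectation_passage:
  assumes [measurable]: "A \<in> sets M" and "0 < \<alpha>"
    and lim: "AE \<omega> in M. (\<lambda>n. scaled_passage X n 1 \<alpha> \<omega>) \<longlonglongrightarrow> \<psi>"
  shows "(\<lambda>n. (\<integral>\<omega>. indicator A \<omega> * last_passage (\<lambda>z. X z \<omega>) n (nat \<lfloor>real n * \<alpha>\<rfloor>) \<partial>M) / real n)
    \<longlonglongrightarrow> prob A * \<psi>"
proof -
  have "(\<lambda>n. \<integral>\<omega>. indicator A \<omega> * scaled_passage X n 1 \<alpha> \<omega> \<partial>M) \<longlonglongrightarrow> (\<integral>\<omega>. indicator A \<omega> * \<psi> \<partial>M)"
  proof (rule integral_dominated_convergence[where w = "\<lambda>_. (1 + \<alpha>) * K"])
    show "AE \<omega> in M. (\<lambda>n. indicator A \<omega> * scaled_passage X n 1 \<alpha> \<omega>) \<longlonglongrightarrow> indicator A \<omega> * \<psi>"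
      using lim by eventually_elim (intro tendsto_mult tendsto_const)
    show "AE \<omega> in M. norm (indicator A \<omega> * scaled_passage X n 1 \<alpha> \<omega>) \<le> (1 + \<alpha>) * K" for n
      using passage_bounded[of n "nat \<lfloor>real n * \<alpha>\<rfloor>"]
    proof eventually_elim
      case (elim \<omega>)
      have "real (nat \<lfloor>real n * \<alpha>\<rfloor>) \<le> real n * \<alpha>" using assms(2) by simp
      then have "real (n + nat \<lfloor>real n * \<alpha>\<rfloor>) * K \<le> (real n + real n * \<alpha>) * K"
        using K by (intro mult_right_mono) auto
      with elim have "\<bar>last_passage (\<lambda>z. X z \<omega>) n (nat \<lfloor>real n * \<alpha>\<rfloor>)\<bar> \<le> real n * ((1 + \<alpha>) * K)"
        by (simp add: algebra_simps)
      then have "\<bar>scaled_passage X n 1 \<alpha> \<omega>\<bar> \<le> (1 + \<alpha>) * K"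
        \<comment> \<open>For \<open>n = 0\<close> the quotient is 0 by the convention on division
          by zero.\<close>
        using assms(2) K by (cases "n = 0") (auto simp: scaled_passage_def abs_divide field_simps)
      then show ?case using assms(2) K by (auto simp: indicator_def)
    qed
  qed (simp_all add: scaled_passage_def)
  then show ?thesis by (simp add: scaled_passage_def)
qed

text \<open>The choices are \<open>l = sqrt \<alpha>\<close> and \<open>L\<close> the least integer
  above or equal to \<open>1 / \<alpha>\<close>. Then \<open>\<alpha> * L \<le> 2\<close> keeps
  \<open>q\<close> below \<open>exp (4 * K\<^sup>2)\<close>, while at most
  \<open>2 * n * \<alpha> + 1\<close> factors, each costing
  \<open>ln (4 * q) / sqrt \<alpha>\<close>, add up to order \<open>n * sqrt \<alpha>\<close>. The
  term \<open>K * \<alpha>\<close> accounts for the means collected on vertical steps.\<close>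

lemma passage_limit_le:
  assumes \<alpha>: "0 < \<alpha>" "\<alpha> \<le> 1" and \<mu>: "\<mu> \<le> K"
    and lim: "AE \<omega> in M. (\<lambda>n. scaled_passage X n 1 \<alpha> \<omega>) \<longlonglongrightarrow> \<psi>"
  shows "\<psi> \<le> \<mu> + K * \<alpha> + 2 * ln (4 * exp (4 * K\<^sup>2)) * sqrt \<alpha>"
proof (rule LIMSEQ_le)
  let ?k = "\<lambda>n. nat \<lfloor>real n * \<alpha>\<rfloor>"
  show "(\<lambda>n. (\<integral>\<omega>. indicator (space M) \<omega> * last_passage (\<lambda>z. X z \<omega>) n (?k n) \<partial>M) / real n) \<longlonglongrightarrow> \<psi>"
    using tendsto_expectation_passage[OF sets.top \<alpha>(1) lim] by (simp add: prob_space)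
  define c where "c = ln (4 * exp (4 * K\<^sup>2))"
  have c0: "0 \<le> c" by (simp add: c_def ln_mult)
  have "(\<lambda>n. \<mu> + K * \<alpha> + 2 * c * sqrt \<alpha> + c / sqrt \<alpha> * (1 / real n)) \<longlonglongrightarrow>
      \<mu> + K * \<alpha> + 2 * c * sqrt \<alpha> + c / sqrt \<alpha> * 0"
    by (intro tendsto_intros lim_1_over_n)
  then show "(\<lambda>n. \<mu> + K * \<alpha> + 2 * c * sqrt \<alpha> + c / sqrt \<alpha> * (1 / real n)) \<longlonglongrightarrow>
      \<mu> + K * \<alpha> + 2 * ln (4 * exp (4 * K\<^sup>2)) * sqrt \<alpha>"
    by (simp add: c_def)
  show "\<exists>N. \<forall>n\<ge>N. (\<integral>\<omega>. indicator (space M) \<omega> * last_passage (\<lambda>z. X z \<omega>) n (?k n) \<partial>M) / real n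
      \<le> \<mu> + K * \<alpha> + 2 * c * sqrt \<alpha> + c / sqrt \<alpha> * (1 / real n)"
  proof (intro exI[of _ 1] allI impI)
    fix n :: nat assume n: "1 \<le> n"
    define L where "L = nat \<lceil>1 / \<alpha>\<rceil>"
    define q where "q = exp (2 * (sqrt \<alpha>)\<^sup>2 * K\<^sup>2 * L)"
    have L1: "1 / \<alpha> \<le> real L" unfolding L_def by (rule real_nat_ceiling_ge)
    then have L0: "0 < L" using \<alpha> by (cases "L = 0") auto
    have "real L \<le> 1 / \<alpha> + 1" unfolding L_def using \<alpha> by (simp add: ceiling_correct)
    then have "\<alpha> * real L \<le> 2" using \<alpha> mult_left_mono[of "real L" "1 / \<alpha> + 1" \<alpha>] by (simp add: distrib_left)
    then have "2 * (sqrt \<alpha>)\<^sup>2 * K\<^sup>2 * L \<le> 4 * K\<^sup>2"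
      using \<alpha> mult_right_mono[of "\<alpha> * real L" 2 "K\<^sup>2"] by (simp add: mult_ac)
    then have "q \<le> exp (4 * K\<^sup>2)" by (simp add: q_def)
    then have lnq: "ln (4 * q) \<le> c" unfolding c_def by (intro ln_mono) (auto simp: q_def)
    have k: "real (?k n) \<le> real n * \<alpha>" using \<alpha> by simp
    have "real (n div L) \<le> real n / real L" by (rule of_nat_div_le_of_nat)
    also have "\<dots> \<le> real n * \<alpha>"
    proof -
      have "1 / real L \<le> \<alpha>" using L1 L0 \<alpha> by (simp add: field_simps)
      from mult_left_mono[OF this, of "real n"] show ?thesis by simp
    qed
    finally have "real (n div L) \<le> real n * \<alpha>" .
    \<comment> \<open>The summand 1 comes from closing the last row; after division by
      \<open>n\<close> it disappears in the limit.\<close>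
    with k have d: "real (Suc (?k n) + n div L) \<le> 2 * real n * \<alpha> + 1"
      unfolding of_nat_add of_nat_Suc by linarith
    have "expectation (\<lambda>\<omega>. last_passage (\<lambda>z. X z \<omega>) n (?k n)) \<le>
        real (n + ?k n) * \<mu> + real (Suc (?k n) + n div L) * ln (4 * q) / sqrt \<alpha>"
      by (rule expectation_passage_le[OF L0 _ q_def]) (use \<alpha> in simp)
    also have "\<dots> \<le> real n * (\<mu> + K * \<alpha>) + (2 * real n * \<alpha> + 1) * c / sqrt \<alpha>"
    proof (intro add_mono divide_right_mono)
      \<comment> \<open>Passing to \<open>K > 0\<close> first allows
        \<open>?k n \<le> n * \<alpha>\<close> to be inserted even if \<open>\<mu>\<close> is
        negative.\<close>
      have "real (?k n) * \<mu> \<le> real (?k n) * K" using \<mu> by (rule mult_left_mono) simp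
      also have "\<dots> \<le> real n * \<alpha> * K" using k K by (intro mult_right_mono) auto
      finally show "real (n + ?k n) * \<mu> \<le> real n * (\<mu> + K * \<alpha>)" by (simp add: algebra_simps)
      have "real (Suc (?k n) + n div L) * ln (4 * q) \<le> real (Suc (?k n) + n div L) * c"
        using lnq by (rule mult_left_mono) simp
      also have "\<dots> \<le> (2 * real n * \<alpha> + 1) * c" using d c0 by (rule mult_right_mono)
      finally show "real (Suc (?k n) + n div L) * ln (4 * q) \<le> (2 * real n * \<alpha> + 1) * c" .
    qed (use \<alpha> in simp)
    also have "(2 * real n * \<alpha> + 1) * c / sqrt \<alpha> = real n * (2 * c * sqrt \<alpha>) + c / sqrt \<alpha>"
      using \<alpha> by (simp add: field_simps)
    finally have "expectation (\<lambda>\<omega>. last_passage (\<lambda>z. X z \<omega>) n (?k n)) / real n \<le>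
        (real n * (\<mu> + K * \<alpha>) + (real n * (2 * c * sqrt \<alpha>) + c / sqrt \<alpha>)) / real n"
      by (rule divide_right_mono) simp
    also have "\<dots> = \<mu> + K * \<alpha> + 2 * c * sqrt \<alpha> + c / sqrt \<alpha> * (1 / real n)"
      using n by (simp add: add_divide_distrib)
    also have "expectation (\<lambda>\<omega>. last_passage (\<lambda>z. X z \<omega>) n (?k n)) =
        (\<integral>\<omega>. indicator (space M) \<omega> * last_passage (\<lambda>z. X z \<omega>) n (?k n) \<partial>M)"
      by (intro Bochner_Integration.integral_cong) auto
    finally show "(\<integral>\<omega>. indicator (space M) \<omega> * last_passage (\<lambda>z. X z \<omega>) n (?k n) \<partial>M) / real n
      \<le> \<mu> + K * \<alpha> + 2 * c * sqrt \<alpha> + c / sqrt \<alpha> * (1 / real n)" .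
  qed
qed

text \<open>Measurability with respect to the environment alone makes
  \<open>{\<omega>. c < dist_mean (F 0 \<omega>)}\<close> an admissible event in
  \<open>expectation_passage_ge\<close>.\<close>

lemma measurable_env_dist_mean: "(\<lambda>\<omega>. dist_mean (F j \<omega>)) \<in> borel_measurable (env_algebra M F)"
proof -
  have "(\<lambda>\<omega> j. F j \<omega>) \<in> measurable (env_algebra M F) (seq_space (prob_algebra borel))"
    unfolding env_algebra_def
    using measurable_space[OF env_algebra_measurable[of F M, OF F]] by (intro measurable_vimage_algebra1) auto
  from measurable_compose[OF this measurable_component_singleton[of j]]
  have "F j \<in> measurable (env_algebra M F) (prob_algebra borel)" by simp
  then show ?thesis
    unfolding dist_mean_def
    by (rule measurable_compose[OF measurable_prob_algebraD integral_measurable_subprob_algebra]) simp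
qed

lemma passage_limit_ge:
  assumes \<alpha>: "0 < \<alpha>" and pos: "0 < prob {\<omega> \<in> space M. c < dist_mean (F 0 \<omega>)}"
    and lim: "AE \<omega> in M. (\<lambda>n. scaled_passage X n 1 \<alpha> \<omega>) \<longlonglongrightarrow> \<psi>"
  shows "c - K * \<alpha> \<le> \<psi>"
proof -
  let ?k = "\<lambda>n. nat \<lfloor>real n * \<alpha>\<rfloor>"
  define A where "A = {\<omega> \<in> space M. c < dist_mean (F 0 \<omega>)}"
  have "{\<omega> \<in> space (env_algebra M F). c < dist_mean (F 0 \<omega>)} \<in> sets (env_algebra M F)"
    using measurable_env_dist_mean[of 0] by measurable
  then have A: "A \<in> sets (env_algebra M F)" by (simp add: A_def env_algebra_def)
  have "prob A * (c - K * \<alpha>) \<le> prob A * \<psi>"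
  proof (rule LIMSEQ_le_const[OF tendsto_expectation_passage[OF env_events[OF A] \<alpha> lim]], intro exI[of _ 1] allI impI)
    fix n :: nat assume n: "1 \<le> n"
    have "real (?k n) * K \<le> real n * \<alpha> * K" using \<alpha> K by (intro mult_right_mono) auto
    then have "real n * (c - K * \<alpha>) \<le> real n * c - real (?k n) * K" by (simp add: algebra_simps)
    then have "prob A * (real n * (c - K * \<alpha>)) \<le> prob A * (real n * c - real (?k n) * K)"
      by (rule mult_left_mono) simp
    also have "\<dots> \<le> (\<integral>\<omega>. indicator A \<omega> * last_passage (\<lambda>z. X z \<omega>) n (?k n) \<partial>M)"
      by (rule expectation_passage_ge[OF A]) (simp add: A_def)
    finally show "prob A * (c - K * \<alpha>) \<le> (\<integral>\<omega>. indicator A \<omega> * last_passage (\<lambda>z. X z \<omega>) n (?k n) \<partial>M) / real n"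
      using n by (simp add: field_simps)
  qed
  \<comment> \<open>Dividing by \<open>prob A > 0\<close> turns an average over a possibly small
    event into a bound on the constant \<open>\<psi>\<close>.\<close>
  then show ?thesis using pos by (simp add: A_def)
qed

end

section \<open>Stationary environments\<close>

text \<open>Projecting the shift-invariant law of the whole sequence to one coordinate shows that
  consecutive rows have the same law.\<close>

lemma stationary_seq_distr:
  assumes "stationary_seq M S F"
  shows "distr M S (F j) = distr M S (F 0)"
proof (induction j)
  case (Suc j)
  have F: "F j \<in> measurable M S" for j using assms by (simp add: stationary_seq_def)
  have m: "(\<lambda>\<omega> j. F (f j) \<omega>) \<in> measurable M (seq_space S)" for f :: "nat \<Rightarrow> nat"
    by (rule measurable_PiM_single') (use F measurable_space[OF F] in \<open>auto simp: space_PiM\<close>)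
  have c: "(\<lambda>s. s j) \<in> measurable (seq_space S) S" by simp
  have "distr M S (F (Suc j)) = distr (distr M (seq_space S) (\<lambda>\<omega> j. F (Suc j) \<omega>)) S (\<lambda>s. s j)"
    using m[of Suc] c by (subst distr_distr) (auto simp: comp_def)
  also have "\<dots> = distr (distr M (seq_space S) (\<lambda>\<omega> j. F j \<omega>)) S (\<lambda>s. s j)"
    using assms by (simp add: stationary_seq_def)
  also have "\<dots> = distr M S (F j)"
    using m[of "\<lambda>j. j"] c by (subst distr_distr) (auto simp: comp_def)
  finally show ?case using Suc by simp
qed simp

text \<open>Whether a measurable property of \<open>F j\<close> holds almost surely depends only on
  the law of \<open>F j\<close>. This carries bounds on row 0 to every row that a path can
  visit.\<close>

lemma stationary_seq_AE:
  assumes F: "stationary_seq M S F" and P: "{G \<in> space S. P G} \<in> sets S" and AE: "AE \<omega> in M. P (F 0 \<omega>)"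
  shows "AE \<omega> in M. P (F j \<omega>)"
proof -
  have Fm: "F j \<in> measurable M S" for j using F by (simp add: stationary_seq_def)
  have "AE G in distr M S (F 0). P G" using AE by (simp add: AE_distr_iff[OF Fm P])
  then have "AE G in distr M S (F j). P G" unfolding stationary_seq_distr[OF F, of j] .
  then show ?thesis by (simp add: AE_distr_iff[OF Fm P])
qed

text \<open>The mass of the interval is a measurable function of \<open>G\<close>, so the left-hand
  form of the support condition can be passed to \<open>stationary_seq_AE\<close>.\<close>

lemma measure_Icc_eq_1_iff:
  assumes "prob_space G" "sets G = sets borel"
  shows "measure G {-K..K::real} = 1 \<longleftrightarrow> (AE x in G. x \<in> {-K..K})"
  using prob_space.AE_in_set_eq_1[OF assms(1), of "{-K..K}"] assms(2) by simp

lemma AE_Icc_of_cdf: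
  assumes G: "prob_space G" "sets G = sets borel" and "0 < K" "cdf G (-K) = 0" "cdf G K = 1"
  shows "AE x in G. x \<in> {-K..K::real}"
proof -
  interpret prob_space G by fact
  interpret finite_borel_measure G by unfold_locales (simp add: G)
  have "prob {-K<..K} = 1"
    using cdf_diff_eq[of "-K" K] assms by simp
  then have "AE x in G. x \<in> {-K<..K}"
    by (subst AE_in_set_eq_1) (simp_all add: G)
  then show ?thesis by eventually_elim auto
qed

theorem theorem4p2p2:
  fixes M :: "'w measure"
    and F :: "nat \<Rightarrow> 'w \<Rightarrow> real measure"
    and X :: "nat \<times> nat \<Rightarrow> 'w \<Rightarrow> real"
    and \<Psi> :: "real \<Rightarrow> real \<Rightarrow> real"
  assumes "prob_space M"
    and "ergodic_seq M (prob_algebra borel) F"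
    and "weights_in_env M F X"
    and "is_passage_limit M X \<Psi>"
    and "\<forall>z. integrable M (X z)"
    and "(\<integral>\<^sup>+ x\<in>{0..}. ennreal (sqrt (1 - (\<integral>\<omega>. cdf (F 0 \<omega>) x \<partial>M))) \<partial>lborel) < \<infinity>"
    and "(\<integral>\<^sup>+ x\<in>{0..}. e2ennreal (esssup M (\<lambda>\<omega>. ereal (1 - cdf (F 0 \<omega>) x))) \<partial>lborel) < \<infinity>"
    and "\<exists>K>0. measure M {\<omega> \<in> space M. cdf (F 0 \<omega>) (-K) = 0 \<and> cdf (F 0 \<omega>) K = 1} = 1"
  shows "(\<lambda>\<alpha>. \<Psi> 1 \<alpha> - mu_star M F) \<in> O[at_right 0](\<lambda>\<alpha>. sqrt \<alpha>)"
proof -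
  interpret prob_space M by fact
  let ?S = "prob_algebra borel :: real measure measure"
  let ?\<mu> = "mu_star M F"
  have stat: "stationary_seq M ?S F" using assms(2) by (simp add: ergodic_seq_def)
  then have F: "F j \<in> measurable M ?S" for j by (simp add: stationary_seq_def)
  have FS: "prob_space (F j \<omega>)" "sets (F j \<omega>) = sets borel" if "\<omega> \<in> space M" for j \<omega>
    using measurable_space[OF F that] by (auto simp: space_prob_algebra)
  obtain K where K: "0 < K" and "prob {\<omega> \<in> space M. cdf (F 0 \<omega>) (-K) = 0 \<and> cdf (F 0 \<omega>) K = 1} = 1" (is "prob ?A = 1")
    using assms(8) by auto
  \<comment> \<open>Sets that are not measurable get \<open>measure\<close> 0, so the value 1 forces
    \<open>?A\<close> to be an event.\<close>
  then have "?A \<in> events" using measure_notin_sets[of ?A M] by fastforce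
  with \<open>prob ?A = 1\<close> have "AE \<omega> in M. \<omega> \<in> ?A" by (subst AE_in_set_eq_1)
  then have "AE \<omega> in M. measure (F 0 \<omega>) {-K..K} = 1"
    using AE_space
    by eventually_elim (simp add: measure_Icc_eq_1_iff[OF FS] AE_Icc_of_cdf[OF FS K] del: atLeastAtMost_iff)
  then have "AE \<omega> in M. measure (F j \<omega>) {-K..K} = 1" for j
    by (rule stationary_seq_AE[OF stat, rotated]) measurable
  then have bounded: "AE \<omega> in M. AE x in F j \<omega>. x \<in> {-K..K}" for j
    using AE_space by eventually_elim (simp add: measure_Icc_eq_1_iff[OF FS] del: atLeastAtMost_iff)
  have dm: "dist_mean \<in> borel_measurable ?S"
    unfolding dist_mean_def
    by (rule measurable_compose[OF measurable_prob_algebraD[OF measurable_ident_sets[OF refl]] integral_measurable_subprob_algebra]) simp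
  have dmF: "(\<lambda>\<omega>. ereal (dist_mean (F 0 \<omega>))) \<in> borel_measurable M"
    using measurable_compose[OF F dm] by simp
  have abs: "AE \<omega> in M. \<bar>dist_mean (F 0 \<omega>)\<bar> \<le> K"
    using bounded[of 0] AE_space by eventually_elim (rule abs_dist_mean_le[OF FS]; assumption)
  let ?e = "esssup M (\<lambda>\<omega>. ereal (dist_mean (F 0 \<omega>)))"
  \<comment> \<open>Bounds from both sides make the essential supremum finite;
    \<open>real_of_ereal\<close> would send an infinite value to 0.\<close>
  have upper: "?e \<le> ereal K"
    by (rule esssup_I[OF dmF], use abs in eventually_elim) auto
  have "AE \<omega> in M. ereal (- K) \<le> ?e"
    using abs esssup_AE[of "\<lambda>\<omega>. ereal (dist_mean (F 0 \<omega>))" M]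
  proof eventually_elim
    case (elim \<omega>)
    have "ereal (- K) \<le> ereal (dist_mean (F 0 \<omega>))" using elim(1) by simp
    then show ?case using elim(2) by (rule order_trans)
  qed
  then have lower: "ereal (- K) \<le> ?e" by simp
  have e: "?e = ereal ?\<mu>" and \<mu>K: "?\<mu> \<le> K"
    using upper lower by (cases ?e; simp add: mu_star_def)+
  have "AE \<omega> in M. dist_mean (F 0 \<omega>) \<le> ?\<mu>"
    using esssup_AE[of "\<lambda>\<omega>. ereal (dist_mean (F 0 \<omega>))" M] unfolding e by simp
  then have mean_le: "AE \<omega> in M. dist_mean (F j \<omega>) \<le> ?\<mu>" for j
    by (rule stationary_seq_AE[OF stat, rotated]) (use dm in measurable)
  interpret bounded_environment M F X K ?\<mu>
    by unfold_locales (fact F assms(3) K bounded mean_le)+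
  \<comment> \<open>Every level strictly below the essential supremum is exceeded with positive
    probability.\<close>
  have pos: "0 < prob {\<omega> \<in> space M. ?\<mu> - \<epsilon> < dist_mean (F 0 \<omega>)}" if "0 < \<epsilon>" for \<epsilon>
  proof -
    have "ereal (?\<mu> - \<epsilon>) < ?e" using that by (simp add: e)
    from esssup_pos_measure[OF dmF this] show ?thesis
      by (simp add: emeasure_eq_measure)
  qed
  define C where "C = K + 2 * ln (4 * exp (4 * K\<^sup>2))"
  have "norm (\<Psi> 1 \<alpha> - ?\<mu>) \<le> C * norm (sqrt \<alpha>)" if \<alpha>: "0 < \<alpha>" "\<alpha> \<le> 1" for \<alpha>
  proof -
    have lim: "AE \<omega> in M. (\<lambda>n. scaled_passage X n 1 \<alpha> \<omega>) \<longlonglongrightarrow> \<Psi> 1 \<alpha>"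
      using assms(4) \<alpha> by (simp add: is_passage_limit_def)
    \<comment> \<open>For \<open>\<alpha> \<le> 1\<close> the linear error terms are absorbed, since
      \<open>\<alpha> \<le> sqrt \<alpha>\<close>.\<close>
    have "\<alpha> = sqrt \<alpha> * sqrt \<alpha>" using \<alpha> by simp
    also have "\<dots> \<le> sqrt \<alpha> * 1" using \<alpha> by (intro mult_left_mono) auto
    finally have "K * \<alpha> \<le> K * sqrt \<alpha>" using K by (intro mult_left_mono) auto
    moreover have "0 \<le> 2 * ln (4 * exp (4 * K\<^sup>2)) * sqrt \<alpha>" using \<alpha> by (simp add: ln_mult)
    moreover have "\<Psi> 1 \<alpha> \<le> ?\<mu> + K * \<alpha> + 2 * ln (4 * exp (4 * K\<^sup>2)) * sqrt \<alpha>"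
      by (rule passage_limit_le[OF \<alpha> \<mu>K lim])
    moreover have "?\<mu> - K * \<alpha> \<le> \<Psi> 1 \<alpha>"
    \<comment> \<open>The level \<open>?\<mu>\<close> itself is almost surely not exceeded, so the
      lower bound is applied at \<open>?\<mu> - \<epsilon>\<close>.\<close>
    proof (rule field_le_epsilon)
      fix \<epsilon> :: real assume "0 < \<epsilon>"
      from passage_limit_ge[OF \<alpha>(1) pos[OF this] lim] show "?\<mu> - K * \<alpha> \<le> \<Psi> 1 \<alpha> + \<epsilon>" by simp
    qed
    ultimately have "\<bar>\<Psi> 1 \<alpha> - ?\<mu>\<bar> \<le> K * sqrt \<alpha> + 2 * ln (4 * exp (4 * K\<^sup>2)) * sqrt \<alpha>"
      by linarith
    then show ?thesis using \<alpha> by (simp add: C_def distrib_right)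
  qed
  moreover have "eventually (\<lambda>\<alpha>. 0 < \<alpha> \<and> \<alpha> \<le> 1) (at_right (0 :: real))"
    by (rule eventually_at_rightI[of 0 1]) auto
  ultimately show ?thesis by (intro bigoI[of _ C]) (auto elim: eventually_mono)
qed

end
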